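(* Let $n\ge 2$ and let $\{1,\dots,n\}=C\,\dot\cup\,D$ be a partition with $|C|=m\ge 1$ and $|D|=n-m\ge 1$. Let $S\in\mathbb{C}^{n\times n}$ be such that $S_{DD}$ is invertible, $\xi\in\mathbb{R}$ with $\xi\neq 0$, $P=\mathrm{diag}(\mathbf 1_{i\in C})$, and let $\widehat K\in\mathbb{C}^{n\times n}$ be Hermitian positive definite; all of these are fixed independently of $b$. For $b>0$ set $\widehat A=S+ib\xi P$ and $G=\widehat A\,\widehat K\,\widehat A^{\mathsf H}$, and let $\rho=\bigl\|\widehat K_{CC}^{-1/2}\widehat K_{CD}\widehat K_{DD}^{-1/2}\bigr\|_2<1$. Consider the descent $r^{j+1}=(I-\eta G)r^{j}$ with the step $\eta=\lambda_{\max}(G)^{-1}$. Let $r^{0}$ be an initial residual with nonzero component on the slow mode. Then the number $j(\tau)$ of iterations needed to reduce the diffusive component of the residual by a factor $\tau\in(0,1)$ satisfies, as $b\to\infty$, $$j(\tau)\ge\kappa(G)\,\log\frac1\tau\,\bigl(1+o(1)\bigr),\qquad \mathrm{Pe}^{2}\,\log\frac1\tau\lesssim j(\tau)\lesssim\frac{\mathrm{Pe}^{2}}{1-\rho^{2}}\,\log\frac1\tau,$$ where $\mathrm{Pe}=\dfrac{b}{\varepsilon_D\,\xi}$.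
   Context: $M^{\mathsf H}$ denotes the conjugate transpose; $\|\cdot\|_2$ the spectral (Euclidean) norm; $\lambda_{\min},\lambda_{\max}$ the smallest and largest eigenvalues of a Hermitian matrix; $\kappa(M)=\lambda_{\max}(M)/\lambda_{\min}(M)$. For $M\in\mathbb{C}^{n\times n}$ and the partition $\{1,\dots,n\}=C\,\dot\cup\,D$, the blocks of $M$ are denoted $M_{CC}$, $M_{CD}$, $M_{DC}$, $M_{DD}$; for $r\in\mathbb{C}^n$, the diffusive component $r_D$ is the subvector of coordinates indexed by $D$. The slow mode is the eigenvector of $G$ associated with $\lambda_{\min}(G)$. The number $j(\tau)$ is the number of iterations needed to have $\|r^{j}_D\|_2\le\tau\|r^{0}_D\|_2$. The P\'eclet number is $\mathrm{Pe}=b/(\varepsilon_D\xi)$, where $\varepsilon_D=\min_{i\in D}\varepsilon_i$ and $\varepsilon_1,\dots,\varepsilon_n>0$ are the fixed diffusion coefficients of the underlying system. The notation $X\lesssim Y$ means $X\le cY$ for all sufficiently large $b$, with a constant $c>0$ independent of $b$.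
   Formalization: The sharp bound fails for some single r^0, so it is proved for the worst case over r^0 with r^0_D nonzero and |r^0_C| at most M|r^0_D|; each such r^0 gets it with log(1/τ) replaced by log(1/τ)+log(|<v,r^0>|/|r^0_D|)+o(1), v the slow mode; the Pe^2 bounds hold for every such r^0. *)

theory Defs
  imports "HOL-Analysis.Analysis"
begin

section \<open>Complex matrices\<close>

definition conj_transpose :: "complex^'n^'m \<Rightarrow> complex^'m^'n" where
  "conj_transpose M = (\<chi> i j. cnj (M $ j $ i))"

definition cdot :: "complex^'n \<Rightarrow> complex^'n \<Rightarrow> complex" where
  "cdot x y = (\<Sum>i\<in>UNIV. cnj (x $ i) * y $ i)"

text \<open>For Hermitian \<open>M\<close> the number \<open>cdot x (M *v x)\<close> is real, so taking its real part loses nothing.\<close>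

definition hermitian_pos_def :: "complex^'n^'n \<Rightarrow> bool" where
  "hermitian_pos_def M \<longleftrightarrow>
     conj_transpose M = M \<and> (\<forall>x. x \<noteq> 0 \<longrightarrow> 0 < Re (cdot x (M *v x)))"

definition eigenvector :: "complex^'n^'n \<Rightarrow> real \<Rightarrow> complex^'n \<Rightarrow> bool" where
  "eigenvector M l v \<longleftrightarrow> v \<noteq> 0 \<and> M *v v = complex_of_real l *s v"

text \<open>Only real eigenvalues are collected; these notions are meant for Hermitian matrices.\<close>

definition eigenvalues :: "complex^'n^'n \<Rightarrow> real set" where
  "eigenvalues M = {l. \<exists>v. eigenvector M l v}"

definition lambda_min :: "complex^'n^'n \<Rightarrow> real" where
  "lambda_min M = Min (eigenvalues M)"

definition lambda_max :: "complex^'n^'n \<Rightarrow> real" where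
  "lambda_max M = Max (eigenvalues M)"

definition kappa :: "complex^'n^'n \<Rightarrow> real" where
  "kappa M = lambda_max M / lambda_min M"

definition spectral_norm :: "complex^'n^'m \<Rightarrow> real" where
  "spectral_norm M = onorm (\<lambda>x. M *v x)"

text \<open>\<open>M\<^sup>-\<^sup>1\<^sup>/\<^sup>2\<close>: the unique Hermitian positive definite square root of the inverse.\<close>

definition inv_sqrt :: "complex^'n^'n \<Rightarrow> complex^'n^'n" where
  "inv_sqrt M = (THE R. hermitian_pos_def R \<and> R ** R = matrix_inv M)"

text \<open>
  A subset of the coordinates is given by an enumeration \<open>f\<close> of it by a finite type, so that a
  block is again a matrix over a type of the right size.
\<close>

definition block :: "('a::finite \<Rightarrow> 'n::finite) \<Rightarrow> ('b::finite \<Rightarrow> 'n) \<Rightarrow> complex^'n^'n \<Rightarrow> complex^'b^'a" where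
  "block f g M = (\<chi> i j. M $ f i $ g j)"

definition subvec :: "('a::finite \<Rightarrow> 'n::finite) \<Rightarrow> complex^'n \<Rightarrow> complex^'a" where
  "subvec f x = (\<chi> i. x $ f i)"

section \<open>The system and the descent\<close>

definition coord_proj :: "'n set \<Rightarrow> complex^'n^'n" where
  "coord_proj C = (\<chi> i j. if i = j \<and> i \<in> C then 1 else 0)"

definition A_hat :: "complex^'n^'n \<Rightarrow> 'n set \<Rightarrow> real \<Rightarrow> real \<Rightarrow> complex^'n^'n" where
  "A_hat S C \<xi> b = S + mat (\<i> * complex_of_real (b * \<xi>)) ** coord_proj C"

definition G_mat ::
  "complex^'n^'n \<Rightarrow> complex^'n^'n \<Rightarrow> 'n set \<Rightarrow> real \<Rightarrow> real \<Rightarrow> complex^'n^'n" where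
  "G_mat S K C \<xi> b = A_hat S C \<xi> b ** K ** conj_transpose (A_hat S C \<xi> b)"

definition rho :: "('c::finite \<Rightarrow> 'n::finite) \<Rightarrow> ('d::finite \<Rightarrow> 'n) \<Rightarrow> complex^'n^'n \<Rightarrow> real" where
  "rho iC iD K =
     spectral_norm (inv_sqrt (block iC iC K) ** block iC iD K ** inv_sqrt (block iD iD K))"

definition peclet :: "('n \<Rightarrow> real) \<Rightarrow> 'n set \<Rightarrow> real \<Rightarrow> real \<Rightarrow> real" where
  "peclet \<epsilon> D \<xi> b = b / (Min (\<epsilon> ` D) * \<xi>)"

definition residual :: "complex^'n^'n \<Rightarrow> complex^'n \<Rightarrow> nat \<Rightarrow> complex^'n" where
  "residual G r0 j = ((\<lambda>r. (mat 1 - (1 / lambda_max G) *\<^sub>R G) *v r) ^^ j) r0"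

text \<open>
  The number of iterations that bring the diffusive component from its initial size down by the
  factor \<open>\<tau>\<close>; it is \<open>\<infinity>\<close> if this never happens.
\<close>

definition iterations ::
  "('d::finite \<Rightarrow> 'n::finite) \<Rightarrow> complex^'n^'n \<Rightarrow> real \<Rightarrow> complex^'n \<Rightarrow> enat" where
  "iterations iD G \<tau> r0 =
     Inf {enat j | j. norm (subvec iD (residual G r0 j)) \<le> \<tau> * norm (subvec iD r0)}"

definition slow_mode :: "complex^'n^'n \<Rightarrow> complex^'n \<Rightarrow> bool" where
  "slow_mode G v \<longleftrightarrow> eigenvector G (lambda_min G) v \<and> norm v = 1"

text \<open>
  Initial residuals with a nonzero component on the slow mode. There must be a diffusive component
  to be reduced, and the rest of the residual is controlled by it through the constant \<open>M\<close>.
  Any fixed \<open>r\<close> with nonzero diffusive component satisfies the last two conditions for all large \<open>M\<close>,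
  independently of \<open>G\<close>. Without the bound by \<open>M\<close> the number of iterations would be unbounded for
  each single \<open>G\<close> that couples the two components.
\<close>

definition initial_residuals ::
  "('c::finite \<Rightarrow> 'n::finite) \<Rightarrow> ('d::finite \<Rightarrow> 'n) \<Rightarrow> complex^'n^'n \<Rightarrow> real \<Rightarrow> (complex^'n) set" where
  "initial_residuals iC iD G M =
     {r. (\<exists>v. slow_mode G v \<and> cdot v r \<noteq> 0) \<and> subvec iD r \<noteq> 0 \<and>
         norm (subvec iC r) \<le> M * norm (subvec iD r)}"

text \<open>
  The number of iterations after which the reduction has been seen for every such initial residual.
  For an individual residual the bound \<open>\<kappa>(G) log (1/\<tau>) (1 + o(1))\<close> can fail: for
  \<open>S = 1\<close>, \<open>K = diag(1,1,2)\<close> and \<open>C\<close> consisting of the first coordinate, \<open>G = diag(1 + b\<^sup>2\<xi>\<^sup>2, 1, 2)\<close>,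
  and for the residual \<open>(0,1,1)\<close> and \<open>\<tau>\<^sup>2 = 3/8\<close> the number of iterations is asymptotically
  \<open>\<kappa>(G) log(2)/2 < \<kappa>(G) log(1/\<tau>)\<close>, since part of the diffusive component lies on a faster mode.
\<close>

definition worst_iterations ::
  "('c::finite \<Rightarrow> 'n::finite) \<Rightarrow> ('d::finite \<Rightarrow> 'n) \<Rightarrow> complex^'n^'n \<Rightarrow> real \<Rightarrow> real \<Rightarrow> enat" where
  "worst_iterations iC iD G M \<tau> = (SUP r\<in>initial_residuals iC iD G M. iterations iD G \<tau> r)"

end

theory Submission
  imports Defs
begin

text \<open>
  For large \<open>b\<close> the form \<open>x \<bullet> G x\<close> sees two scales. On the coordinates in \<open>D\<close> it does not involve
  \<open>b\<close> at all, so it is at most \<open>a \<parallel>x\<parallel>\<^sup>2\<close> there; on all vectors it dominates \<open>(c b)\<^sup>2 \<parallel>x\<^sub>C\<parallel>\<^sup>2\<close>, since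
  \<open>A\<^sup>H x\<close> contains the term \<open>- \<i> b \<xi> x\<^sub>C\<close>, and it dominates \<open>l\<^sub>0 \<parallel>x\<parallel>\<^sup>2\<close>, since \<open>S\<^sub>D\<^sub>D\<close> is invertible
  (lemma \<open>G_mat_estimates\<close>). Hence \<open>\<lambda>\<^sub>m\<^sub>i\<^sub>n\<close> stays between positive constants, \<open>\<lambda>\<^sub>m\<^sub>a\<^sub>x\<close> is of order
  \<open>b\<^sup>2\<close>, and \<open>\<kappa>(G)\<close> is of order \<open>Pe\<^sup>2\<close>.

  Write \<open>T\<close> for the \<open>j\<close>-th power of \<open>I - G / \<lambda>\<^sub>m\<^sub>a\<^sub>x\<close>. The difficulty is that an initial residual may
  carry a component in \<open>C\<close> that is \<open>M\<close> times as large as the diffusive one, while the constants must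
  not depend on \<open>M\<close>. What resolves it is that \<open>T\<close> transfers only \<open>\<delta> = O(1/b)\<close> from \<open>C\<close> to \<open>D\<close>, for
  all \<open>j\<close> at once (lemma \<open>cross_talk\<close>). By symmetry of \<open>T\<close> it suffices to bound \<open>(T u)\<^sub>C\<close> for \<open>u\<close>
  supported on \<open>D\<close>, and \<open>T\<close> does not increase the energy:
  \<open>(c b)\<^sup>2 \<parallel>(T u)\<^sub>C\<parallel>\<^sup>2 \<le> T u \<bullet> G (T u) \<le> u \<bullet> G u \<le> a \<parallel>u\<parallel>\<^sup>2\<close>.

  Up to an error of relative size \<open>\<delta> M\<close>, which vanishes as \<open>b \<rightarrow> \<infinity>\<close>, the diffusive component then
  evolves as if \<open>r\<^sub>C\<close> were zero. It is at most \<open>(1 - 1/\<kappa>)\<^sup>j \<parallel>r\<^sub>D\<parallel>\<close>, which gives the upper bound.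
  Convexity of \<open>t \<mapsto> t\<^sup>j\<close> gives \<open>u \<bullet> T u \<ge> (1 - a/\<lambda>\<^sub>m\<^sub>a\<^sub>x)\<^sup>j \<parallel>u\<parallel>\<^sup>2\<close> for \<open>u\<close> supported on \<open>D\<close>
  (lemma \<open>jensen_iter\<close>), whence the lower bound of order \<open>Pe\<^sup>2\<close>. The component on a slow mode decays
  exactly like \<open>(1 - 1/\<kappa>)\<^sup>j\<close>, and a slow mode lives on \<open>D\<close> up to \<open>\<delta>\<close>, so that component is visible in
  \<open>r\<^sub>D\<close>; this gives the sharp lower bound, and for the worst case the initial residual is a slow mode
  itself.

  All spectral arguments are carried out in the real inner product space underlying \<open>\<complex>\<^sup>n\<close>, whose inner
  product is the real part of the Hermitian one: a Hermitian matrix is self-adjoint there and has the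
  same real eigenvalues and the same eigenvectors.
\<close>

section \<open>Self-adjoint operators have orthonormal eigenbases\<close>

locale self_adjoint =
  fixes f :: "'a::euclidean_space \<Rightarrow> 'a"
  assumes linear: "linear f"
    and adjoint: "f x \<bullet> y = x \<bullet> f y"
begin

text \<open>
  The form \<open>\<mu> (x \<bullet> x) - x \<bullet> f x\<close> is nonnegative on \<open>S\<close> and vanishes at \<open>v\<close>, so \<open>v\<close> minimises it and its
  derivative at \<open>v\<close> in the direction \<open>w = \<mu> v - f v\<close>, which is \<open>2 (w \<bullet> w)\<close>, must vanish.
\<close>

lemma max_rayleigh_eigenvector:
  assumes S: "subspace S" "f ` S \<subseteq> S" and v: "v \<in> S"
    and max: "\<And>x. x \<in> S \<Longrightarrow> x \<bullet> f x \<le> \<mu> * (x \<bullet> x)" and eq: "v \<bullet> f v = \<mu> * (v \<bullet> v)"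
  shows "f v = \<mu> *\<^sub>R v"
proof -
  define w where "w = \<mu> *\<^sub>R v - f v"
  have w: "w \<in> S"
    using S v by (auto simp: w_def subspace_diff subspace_scale)
  define A where "A = \<mu> * (w \<bullet> w) - w \<bullet> f w"
  have A: "0 \<le> A"
    using max[OF w] by (simp add: A_def)
  have quad: "2 * (w \<bullet> w) * s \<le> A * s\<^sup>2" for s :: real
  proof -
    have "v - s *\<^sub>R w \<in> S"
      using S v w by (simp add: subspace_diff subspace_scale)
    note le = max[OF this]
    have f: "f (v - s *\<^sub>R w) = f v - s *\<^sub>R f w"
      by (simp add: linear linear_diff linear_scale)
    have fv: "f v = \<mu> *\<^sub>R v - w"
      by (simp add: w_def)
    have c: "v \<bullet> f w = w \<bullet> f v"
      by (metis adjoint inner_commute)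
    show ?thesis
      using le eq c unfolding f A_def
      by (simp add: fv algebra_simps inner_diff_left inner_diff_right power2_eq_square inner_commute)
  qed
  have "w \<bullet> w = 0"
  proof (rule ccontr)
    assume "w \<bullet> w \<noteq> 0"
    then have p: "0 < w \<bullet> w"
      by simp
    \<comment> \<open>so small that the linear term \<open>2 s (w \<bullet> w)\<close> outweighs the quadratic term \<open>A s\<^sup>2\<close>\<close>
    define s where "s = (w \<bullet> w) / (A + 1)"
    have s: "0 < s" "s * (A + 1) = w \<bullet> w"
      using p A by (auto simp: s_def)
    have "2 * (w \<bullet> w) \<le> A * s"
      using quad[of s] s(1) by (simp add: power2_eq_square)
    also have "\<dots> \<le> w \<bullet> w"
      using s by (simp add: algebra_simps)
    finally show False
      using p by simp
  qed
  then show ?thesis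
    by (simp add: w_def)
qed

lemma eigenvector_in_invariant_subspace:
  assumes S: "subspace S" "f ` S \<subseteq> S" and "S \<noteq> {0}"
  obtains v where "v \<in> S" "norm v = 1" "f v = (v \<bullet> f v) *\<^sub>R v"
proof -
  let ?K = "S \<inter> sphere 0 1"
  have "compact ?K"
    by (simp add: S closed_subspace closed_Int_compact)
  moreover obtain x where x: "x \<in> S" "x \<noteq> 0"
    using assms subspace_0 by blast
  then have "x /\<^sub>R norm x \<in> ?K"
    using S by (simp add: subspace_scale)
  then have "?K \<noteq> {}"
    by blast
  moreover have "continuous_on ?K (\<lambda>x. x \<bullet> f x)"
    by (intro continuous_intros linear_continuous_on linear_linear[THEN iffD1] linear)
       (simp add: linear linear_conv_bounded_linear[symmetric])
  ultimately obtain v where v: "v \<in> ?K" and max: "\<And>x. x \<in> ?K \<Longrightarrow> x \<bullet> f x \<le> v \<bullet> f v"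
    using continuous_attains_sup[of ?K "\<lambda>x. x \<bullet> f x"] by blast
  have "f v = (v \<bullet> f v) *\<^sub>R v"
  proof (rule max_rayleigh_eigenvector[OF S])
    fix x assume x: "x \<in> S"
    show "x \<bullet> f x \<le> (v \<bullet> f v) * (x \<bullet> x)"
    proof (cases "x = 0")
      case False
      have "x /\<^sub>R norm x \<in> ?K"
        using S False x by (simp add: subspace_scale)
      from max[OF this] have "(x \<bullet> f x) / (norm x)\<^sup>2 \<le> v \<bullet> f v"
        by (simp add: linear linear_scale power2_eq_square field_simps)
      then show ?thesis
        using False by (simp add: power2_norm_eq_inner field_simps)
    qed (simp add: linear linear_0)
  qed (use v in \<open>auto simp: dot_square_norm\<close>)
  then show thesis
    using v that[of v] by auto
qed

text \<open>
  Split off one eigenvector; the orthogonal complement of it in \<open>S\<close> is invariant again, because \<open>f\<close> is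
  self-adjoint.
\<close>

lemma eigenbasis_of_invariant_subspace:
  assumes "subspace S" "f ` S \<subseteq> S"
  shows "\<exists>B. finite B \<and> pairwise orthogonal B \<and> span B = S \<and>
    (\<forall>b\<in>B. norm b = 1 \<and> f b = (b \<bullet> f b) *\<^sub>R b)"
  using assms
proof (induction "dim S" arbitrary: S rule: less_induct)
  case less
  show ?case
  proof (cases "S = {0}")
    case True
    then show ?thesis
      by (intro exI[of _ "{}"]) auto
  next
    case False
    then obtain v where v: "v \<in> S" "norm v = 1" "f v = (v \<bullet> f v) *\<^sub>R v"
      using eigenvector_in_invariant_subspace less.prems by blast
    let ?T = "S \<inter> {x. v \<bullet> x = 0}"
    have T: "subspace ?T"
      by (simp add: less.prems subspace_hyperplane subspace_inter)
    have "f ` ?T \<subseteq> ?T"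
    proof
      fix y assume "y \<in> f ` ?T"
      then obtain x where x: "x \<in> S" "v \<bullet> x = 0" and y: "y = f x"
        by blast
      have "v \<bullet> f x = f v \<bullet> x"
        by (simp add: adjoint)
      also have "\<dots> = (v \<bullet> f v) * (v \<bullet> x)"
        by (subst v(3)) simp
      finally show "y \<in> ?T"
        using x y less.prems by auto
    qed
    moreover have "v \<notin> ?T"
      using v by (auto simp: dot_square_norm)
    then have "dim ?T < dim S"
      using subspace_dim_equal[OF T less.prems(1)] v(1)
      by (metis dim_subset inf_le1 nat_less_le order_refl linorder_not_le)
    ultimately obtain B where B: "finite B" "pairwise orthogonal B" "span B = ?T"
      "\<forall>b\<in>B. norm b = 1 \<and> f b = (b \<bullet> f b) *\<^sub>R b"
      using less.hyps[of ?T] T by blast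
    have "pairwise orthogonal (insert v B)"
    proof -
      have "v \<bullet> b = 0" if "b \<in> B" for b
        using B(3) span_base[OF that] by blast
      then show ?thesis
        using B(2) by (auto simp: pairwise_insert orthogonal_def inner_commute)
    qed
    moreover have "span (insert v B) = S"
    proof
      show "span (insert v B) \<subseteq> S"
        using B(3) span_superset[of B] v(1) by (intro span_minimal) (auto simp: less.prems)
      show "S \<subseteq> span (insert v B)"
      proof
        fix x assume x: "x \<in> S"
        have "x - (v \<bullet> x) *\<^sub>R v \<in> ?T"
          using x v less.prems
          by (simp add: subspace_diff subspace_scale inner_diff_right dot_square_norm)
        then show "x \<in> span (insert v B)"
          using B(3) by (metis span_breakdown_eq)
      qed
    qed
    ultimately show ?thesis
      using B v by (intro exI[of _ "insert v B"]) auto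
  qed
qed

end

text \<open>
  Eigenvalues are not listed separately: the one belonging to a unit eigenvector \<open>b\<close> is \<open>b \<bullet> f b\<close>.
\<close>

definition orthonormal_eigenbasis :: "('a::euclidean_space \<Rightarrow> 'a) \<Rightarrow> 'a set \<Rightarrow> bool" where
  "orthonormal_eigenbasis f B \<longleftrightarrow> finite B \<and> pairwise orthogonal B \<and> span B = UNIV \<and>
     (\<forall>b\<in>B. norm b = 1 \<and> f b = (b \<bullet> f b) *\<^sub>R b)"

theorem (in self_adjoint) orthonormal_eigenbasis_exists:
  "\<exists>B. orthonormal_eigenbasis f B"
  using eigenbasis_of_invariant_subspace[of UNIV] by (auto simp: orthonormal_eigenbasis_def)

locale spectral = self_adjoint +
  fixes B
  assumes basis: "orthonormal_eigenbasis f B"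
begin

abbreviation ev :: "'a \<Rightarrow> real" where
  "ev b \<equiv> b \<bullet> f b"

lemma finite_basis: "finite B"
  and norm_basis: "b \<in> B \<Longrightarrow> norm b = 1"
  using basis by (auto simp: orthonormal_eigenbasis_def)

lemma apply_basis: "b \<in> B \<Longrightarrow> f b = ev b *\<^sub>R b"
  using basis unfolding orthonormal_eigenbasis_def by blast

lemma expansion: "(\<Sum>b\<in>B. (x \<bullet> b) *\<^sub>R b) = x"
  using basis by (intro orthonormal_basis_expand) (auto simp: orthonormal_eigenbasis_def)

lemma parseval: "x \<bullet> y = (\<Sum>b\<in>B. (x \<bullet> b) * (y \<bullet> b))"
proof -
  have "x \<bullet> y = x \<bullet> (\<Sum>b\<in>B. (y \<bullet> b) *\<^sub>R b)"
    by (simp add: expansion)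
  then show ?thesis
    by (simp add: inner_sum_right mult.commute)
qed

lemma norm_sq: "(norm x)\<^sup>2 = (\<Sum>b\<in>B. (x \<bullet> b)\<^sup>2)"
  unfolding power2_norm_eq_inner parseval[of x x] by (simp add: power2_eq_square)

lemma apply_coeff: "b \<in> B \<Longrightarrow> f x \<bullet> b = ev b * (x \<bullet> b)"
  by (subst adjoint, subst apply_basis) simp_all

lemma rayleigh: "x \<bullet> f x = (\<Sum>b\<in>B. ev b * (x \<bullet> b)\<^sup>2)"
  unfolding parseval[of x "f x"] by (intro sum.cong) (simp_all add: apply_coeff power2_eq_square)

lemma coeff_neq_0: "x \<noteq> 0 \<Longrightarrow> \<exists>b\<in>B. x \<bullet> b \<noteq> 0"
  using norm_sq[of x] by (auto intro: ccontr)

lemma eigenvalue_cases: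
  assumes "v \<noteq> 0" "f v = l *\<^sub>R v"
  shows "\<exists>b\<in>B. l = ev b"
proof -
  obtain b where b: "b \<in> B" "v \<bullet> b \<noteq> 0"
    using coeff_neq_0 assms by blast
  then have "l * (v \<bullet> b) = ev b * (v \<bullet> b)"
    using apply_coeff[OF b(1), of v] assms by simp
  then show ?thesis
    using b by auto
qed

lemma basis_nonempty: "B \<noteq> {}"
proof -
  obtain i :: 'a where "i \<in> Basis"
    by (metis ex_in_conv nonempty_Basis)
  then show ?thesis
    using coeff_neq_0[of i] nonzero_Basis by fastforce
qed

end

section \<open>Steepest descent in an eigenbasis\<close>

definition descent_iter :: "('a::real_vector \<Rightarrow> 'a) \<Rightarrow> real \<Rightarrow> nat \<Rightarrow> 'a \<Rightarrow> 'a" where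
  "descent_iter f L j = (\<lambda>x. x - (1 / L) *\<^sub>R f x) ^^ j"

text \<open>
  The interval \<open>[l, L]\<close> contains the spectrum, so that the step \<open>1 / L\<close> damps the mode with eigenvalue
  \<open>\<lambda>\<close> by the factor \<open>1 - \<lambda> / L \<in> [0, 1]\<close>.
\<close>

locale descent = spectral +
  fixes l L :: real
  assumes l_pos: "0 < l"
    and bounds: "b \<in> B \<Longrightarrow> l \<le> ev b \<and> ev b \<le> L"
begin

lemma L_pos: "0 < L" and l_le_L: "l \<le> L"
  using basis_nonempty bounds l_pos by force+

abbreviation iter :: "nat \<Rightarrow> 'a \<Rightarrow> 'a" where
  "iter \<equiv> descent_iter f L"

definition damping :: "nat \<Rightarrow> 'a \<Rightarrow> real" where
  "damping j b = (1 - ev b / L) ^ j"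

lemma iter_coeff: "b \<in> B \<Longrightarrow> iter j x \<bullet> b = damping j b * (x \<bullet> b)"
  by (induction j)
     (simp_all add: descent_iter_def damping_def inner_diff_left apply_coeff algebra_simps)

lemma damping_nonneg: "b \<in> B \<Longrightarrow> 0 \<le> damping j b"
  and damping_le: "b \<in> B \<Longrightarrow> damping j b \<le> (1 - l / L) ^ j"
  and damping_le_1: "b \<in> B \<Longrightarrow> damping j b \<le> 1"
proof -
  assume "b \<in> B"
  then have *: "0 \<le> ev b / L" "l / L \<le> ev b / L" "ev b / L \<le> 1"
    using bounds[of b] L_pos l_pos by (auto simp: field_simps)
  then show "0 \<le> damping j b" "damping j b \<le> (1 - l / L) ^ j" "damping j b \<le> 1"
    by (auto simp: damping_def intro!: power_mono power_le_one)
qed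

lemma iter_self_adjoint: "iter j x \<bullet> y = x \<bullet> iter j y"
  unfolding parseval[of "iter j x" y] parseval[of x "iter j y"]
  by (intro sum.cong) (simp_all add: iter_coeff)

lemma iter_add: "iter j (x + y) = iter j x + iter j y"
proof -
  have "iter j (x + y) \<bullet> z = (iter j x + iter j y) \<bullet> z" for z
    by (simp add: iter_self_adjoint inner_add_left)
  then show ?thesis
    by (metis vector_eq_rdot)
qed

lemma norm_iter_le: "norm (iter j x) \<le> (1 - l / L) ^ j * norm x"
proof (rule power2_le_imp_le)
  have "(norm (iter j x))\<^sup>2 = (\<Sum>b\<in>B. (damping j b)\<^sup>2 * (x \<bullet> b)\<^sup>2)"
    unfolding norm_sq by (intro sum.cong) (simp_all add: iter_coeff power_mult_distrib)
  also have "\<dots> \<le> (\<Sum>b\<in>B. ((1 - l / L) ^ j)\<^sup>2 * (x \<bullet> b)\<^sup>2)"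
    by (intro sum_mono mult_right_mono power_mono damping_le damping_nonneg) auto
  finally show "(norm (iter j x))\<^sup>2 \<le> ((1 - l / L) ^ j * norm x)\<^sup>2"
    by (simp add: norm_sq power_mult_distrib sum_distrib_left)
  show "0 \<le> (1 - l / L) ^ j * norm x"
    using l_le_L L_pos by simp
qed

lemma norm_iter_le_norm: "norm (iter j x) \<le> norm x"
proof -
  have "(1 - l / L) ^ j \<le> 1"
    using l_le_L L_pos l_pos by (intro power_le_one) auto
  then show ?thesis
    using norm_iter_le[of j x] mult_right_mono[of "(1 - l / L) ^ j" 1 "norm x"] by simp
qed

text \<open>
  Every mode is damped and the energy is a sum over the modes with nonnegative weights. In contrast
  to norms, this controls an iterate by the energy of its initial value, which can be far smaller
  than \<open>L \<parallel>x\<parallel>\<^sup>2\<close>.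
\<close>

lemma iter_energy_le: "iter j x \<bullet> f (iter j x) \<le> x \<bullet> f x"
proof -
  have "ev b * (damping j b * (x \<bullet> b))\<^sup>2 \<le> ev b * (x \<bullet> b)\<^sup>2" if "b \<in> B" for b
  proof -
    have "(damping j b)\<^sup>2 \<le> 1"
      using that by (simp add: power_le_one damping_nonneg damping_le_1)
    then have "(damping j b * (x \<bullet> b))\<^sup>2 \<le> (x \<bullet> b)\<^sup>2"
      by (simp add: power_mult_distrib mult_left_le_one_le)
    then show ?thesis
      using bounds[OF that] l_pos by (intro mult_left_mono) auto
  qed
  then show ?thesis
    unfolding rayleigh[of x] rayleigh[of "iter j x"] by (intro sum_mono) (simp add: iter_coeff)
qed

text \<open>
  With the weights \<open>(u \<bullet> b)\<^sup>2 / \<parallel>u\<parallel>\<^sup>2\<close> on the modes, the Rayleigh quotient of \<open>u\<close> is the mean of the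
  eigenvalues and \<open>u \<bullet> iter j u / \<parallel>u\<parallel>\<^sup>2\<close> is the mean of the damping factors \<open>(1 - \<lambda> / L)\<^sup>j\<close>. The latter
  are convex in \<open>\<lambda>\<close>, so Jensen's inequality applies. A bound through the largest \<open>\<lambda>\<close> would be useless
  here, since \<open>u\<close> may have components on fast modes.
\<close>

lemma jensen_iter:
  assumes u: "u \<bullet> f u \<le> a * (norm u)\<^sup>2" and "a \<le> L"
  shows "(1 - a / L) ^ j * (norm u)\<^sup>2 \<le> u \<bullet> iter j u"
proof (cases "u = 0")
  case False
  define w where "w b = (u \<bullet> b)\<^sup>2 / (norm u)\<^sup>2" for b
  have n: "0 < (norm u)\<^sup>2"
    using False by simp
  have w: "(\<Sum>b\<in>B. w b) = 1"
    using n unfolding w_def by (simp add: norm_sq[of u] flip: sum_divide_distrib)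
  have conv: "convex_on {0::real..} (\<lambda>x. x ^ j)"
    by (cases "even j") (auto intro: convex_on_subset[OF convex_power_even] convex_power_odd)
  have mean: "(\<Sum>b\<in>B. w b * (1 - ev b / L)) = 1 - (u \<bullet> f u) / (norm u)\<^sup>2 / L"
  proof -
    have "(\<Sum>b\<in>B. w b * (1 - ev b / L)) = (\<Sum>b\<in>B. w b) - (\<Sum>b\<in>B. w b * (ev b / L))"
      by (simp add: right_diff_distrib sum_subtractf)
    also have "(\<Sum>b\<in>B. w b * (ev b / L)) = (u \<bullet> f u) / (norm u)\<^sup>2 / L"
      unfolding rayleigh[of u] sum_divide_distrib by (intro sum.cong) (simp_all add: w_def)
    finally show ?thesis
      by (simp add: w)
  qed
  have "(1 - a / L) ^ j \<le> (1 - (u \<bullet> f u) / (norm u)\<^sup>2 / L) ^ j"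
    using u n L_pos \<open>a \<le> L\<close> by (intro power_mono) (auto simp: field_simps)
  also have "\<dots> \<le> (\<Sum>b\<in>B. w b * (1 - ev b / L) ^ j)"
  proof -
    have "w b \<ge> 0" "1 - ev b / L \<in> {0..}" if "b \<in> B" for b
      using bounds[OF that] L_pos by (simp_all add: w_def)
    note convex = convex_on_sum[where y = "\<lambda>b. 1 - ev b / L", OF finite_basis basis_nonempty conv w this]
    show ?thesis
      using convex[unfolded real_scaleR_def mean] .
  qed
  also have "\<dots> = (u \<bullet> iter j u) / (norm u)\<^sup>2"
  proof -
    have "u \<bullet> iter j u = (\<Sum>b\<in>B. damping j b * (u \<bullet> b)\<^sup>2)"
      unfolding parseval[of u "iter j u"] by (intro sum.cong) (simp_all add: iter_coeff power2_eq_square)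
    then show ?thesis
      by (simp add: w_def damping_def sum_divide_distrib mult.commute)
  qed
  finally show ?thesis
    using n by (simp add: field_simps)
qed simp

lemma iter_eigenvector:
  assumes "f v = l *\<^sub>R v"
  shows "iter j v = (1 - l / L) ^ j *\<^sub>R v"
proof (induction j)
  case (Suc j)
  have "iter (Suc j) v = iter j v - (1 / L) *\<^sub>R f (iter j v)"
    by (simp add: descent_iter_def)
  then show ?case
    by (simp add: Suc linear linear_scale assms algebra_simps)
qed (simp add: descent_iter_def)

end

text \<open>
  The orthogonal projection \<open>p\<close> selects the stiff coordinates, on which a vector costs energy of at
  least \<open>\<beta>\<^sup>2\<close> times its squared norm; vectors without stiff part have energy at most \<open>a\<close> times their
  squared norm. In the application \<open>\<beta>\<close> is proportional to \<open>b\<close>, while \<open>a\<close> does not depend on \<open>b\<close>.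
\<close>

locale split_descent = descent +
  fixes p :: "'a \<Rightarrow> 'a" and a \<beta> :: real
  assumes p_adjoint: "p x \<bullet> y = x \<bullet> p y"
    and p_idem: "p (p x) = p x"
    and \<beta>_pos: "0 < \<beta>"
    and stiff: "\<beta>\<^sup>2 * (norm (p x))\<^sup>2 \<le> x \<bullet> f x"
    and soft: "p u = 0 \<Longrightarrow> u \<bullet> f u \<le> a * (norm u)\<^sup>2"
    and a_pos: "0 < a" and a_le_L: "a \<le> L" and l_le_a: "l \<le> a"
begin

text \<open>
  The ratio of the two scales, which bounds how much of a vector of low energy is stiff and also how
  much the descent transfers between the two parts.
\<close>

definition \<delta> :: real where "\<delta> = sqrt a / \<beta>"

abbreviation q :: "'a \<Rightarrow> 'a" where "q x \<equiv> x - p x"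

lemma \<delta>_nonneg: "0 \<le> \<delta>"
  using \<beta>_pos a_pos by (simp add: \<delta>_def)

lemma p_diff: "p (x - y) = p x - p y"
proof -
  have "p (x - y) \<bullet> z = (p x - p y) \<bullet> z" for z
    by (simp add: p_adjoint inner_diff_left)
  then show ?thesis
    by (metis vector_eq_rdot)
qed

lemma p_q: "p (q x) = 0"
  by (simp add: p_diff p_idem)

lemma norm_q_le: "norm (q x) \<le> norm x"
proof -
  have "p x \<bullet> q x = 0"
    by (metis p_adjoint p_q inner_zero_right)
  then have "(norm x)\<^sup>2 = (norm (p x))\<^sup>2 + (norm (q x))\<^sup>2"
    using norm_add_Pythagorean[of "p x" "q x"] by (simp add: orthogonal_def)
  then show ?thesis
    by (auto intro: power2_le_imp_le)
qed

lemma q_adjoint: "q x \<bullet> y = x \<bullet> q y"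
  by (simp add: inner_diff_left inner_diff_right p_adjoint)

lemma energy_imp_small:
  assumes "x \<bullet> f x \<le> a * c\<^sup>2" "0 \<le> c"
  shows "norm (p x) \<le> \<delta> * c"
proof (rule power2_le_imp_le)
  have "\<beta>\<^sup>2 * (norm (p x))\<^sup>2 \<le> a * c\<^sup>2"
    using stiff assms order_trans by blast
  then show "(norm (p x))\<^sup>2 \<le> (\<delta> * c)\<^sup>2"
    using a_pos \<beta>_pos by (simp add: \<delta>_def power_mult_distrib power_divide field_simps)
qed (use \<delta>_nonneg assms in simp)

text \<open>
  Pairing \<open>w = q (iter j (p r))\<close> with itself and moving the iteration to the other side turns the
  transfer from stiff to soft into the transfer from soft to stiff. The latter is small since \<open>w\<close> is
  soft, so \<open>iter j w\<close> has low energy and can have only a small stiff part. The bound is uniform in \<open>j\<close>.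
\<close>

lemma cross_talk: "norm (q (iter j (p r))) \<le> \<delta> * norm (p r)"
proof -
  define w where "w = q (iter j (p r))"
  have pw: "p w = 0"
    by (simp add: w_def p_q)
  have small: "norm (p (iter j w)) \<le> \<delta> * norm w"
    using energy_imp_small[of "iter j w" "norm w"] iter_energy_le[of j w] soft[OF pw] by simp
  have "(norm w)\<^sup>2 = w \<bullet> q (iter j (p r))"
    by (simp add: w_def power2_norm_eq_inner)
  also have "\<dots> = w \<bullet> iter j (p r)"
    using pw by (simp flip: q_adjoint)
  also have "\<dots> = p (iter j w) \<bullet> p r"
    by (metis iter_self_adjoint p_adjoint p_idem)
  also have "\<dots> \<le> norm (p (iter j w)) * norm (p r)"
    by (rule norm_cauchy_schwarz)
  also have "\<dots> \<le> \<delta> * norm w * norm (p r)"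
    by (intro mult_right_mono small) simp
  finally have "norm w * norm w \<le> norm w * (\<delta> * norm (p r))"
    by (simp add: power2_eq_square algebra_simps)
  then show ?thesis
    using \<delta>_nonneg by (cases "w = 0") (simp_all flip: w_def)
qed

lemma q_iter_split: "q (iter j r) = q (iter j (q r)) + q (iter j (p r))"
proof -
  have "iter j r = iter j (q r) + iter j (p r)"
    by (simp flip: iter_add)
  moreover have "p (x + y) = p x + p y" for x y
    using p_diff[of "x + y" y] by simp
  ultimately show ?thesis
    by simp
qed

context
  fixes r :: 'a and M :: real
  assumes M: "norm (p r) \<le> M * norm (q r)"
begin

lemma cross_talk_relative: "norm (q (iter j (p r))) \<le> \<delta> * M * norm (q r)"
  using cross_talk[of j r] mult_left_mono[OF M \<delta>_nonneg] by simp

lemma norm_q_iter_le: "norm (q (iter j r)) \<le> ((1 - l / L) ^ j + \<delta> * M) * norm (q r)"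
proof -
  have "norm (q (iter j r)) \<le> norm (q (iter j (q r))) + norm (q (iter j (p r)))"
    unfolding q_iter_split[of j r] by (rule norm_triangle_ineq)
  also have "norm (q (iter j (q r))) \<le> (1 - l / L) ^ j * norm (q r)"
    using norm_q_le norm_iter_le order_trans by blast
  finally show ?thesis
    using cross_talk_relative[of j] by (simp add: algebra_simps)
qed

lemma norm_q_iter_ge: "((1 - a / L) ^ j - \<delta> * M) * norm (q r) \<le> norm (q (iter j r))"
proof -
  have "(1 - a / L) ^ j * (norm (q r))\<^sup>2 \<le> q r \<bullet> iter j (q r)"
    by (intro jensen_iter soft p_q a_le_L)
  also have "\<dots> = q r \<bullet> q (iter j (q r))"
    using q_adjoint[of "q r" "iter j (q r)"] by (simp add: p_q)
  also have "\<dots> \<le> norm (q r) * norm (q (iter j (q r)))"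
    by (rule norm_cauchy_schwarz)
  finally have "(1 - a / L) ^ j * norm (q r) \<le> norm (q (iter j (q r)))"
    by (cases "q r = 0") (simp_all add: power2_eq_square)
  moreover have "norm (q (iter j (q r))) \<le> norm (q (iter j r)) + norm (q (iter j (p r)))"
    unfolding q_iter_split[of j r]
    by (metis add_diff_cancel_right' norm_triangle_ineq4)
  ultimately show ?thesis
    using cross_talk_relative[of j] by (simp add: algebra_simps)
qed

text \<open>
  The component of the iterates along a slow mode \<open>v\<close> decays at a known rate. Since \<open>v\<close> has low energy,
  \<open>\<parallel>p v\<parallel> \<le> \<delta>\<close>, and what is left of the component must be found in the soft part of the iterate.
\<close>

lemma slow_component_bounds:
  assumes v: "f v = l *\<^sub>R v" "norm v = 1"
  shows "(1 - l / L) ^ j * \<bar>v \<bullet> r\<bar> \<le> norm (q (iter j r)) + \<delta> * (1 + M) * norm (q r)"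
    and "\<bar>v \<bullet> r\<bar> \<le> (1 + M) * norm (q r)"
proof -
  have nr: "norm r \<le> (1 + M) * norm (q r)"
    using M norm_triangle_ineq[of "q r" "p r"] by (simp add: algebra_simps)
  have "v \<bullet> f v \<le> a * 1\<^sup>2"
    using v l_le_a by (simp add: dot_square_norm)
  then have pv: "norm (p v) \<le> \<delta>"
    using energy_imp_small[of v 1] by simp
  show "\<bar>v \<bullet> r\<bar> \<le> (1 + M) * norm (q r)"
    using Cauchy_Schwarz_ineq2[of v r] nr v by simp
  have "(1 - l / L) ^ j * (v \<bullet> r) = v \<bullet> iter j r"
    using iter_eigenvector[OF v(1), of j] by (simp flip: iter_self_adjoint)
  also have "\<dots> = v \<bullet> q (iter j r) + p v \<bullet> iter j r"
    by (simp add: p_adjoint inner_diff_right)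
  finally have *: "(1 - l / L) ^ j * (v \<bullet> r) = v \<bullet> q (iter j r) + p v \<bullet> iter j r" .
  have "0 \<le> (1 - l / L) ^ j"
    using l_le_L L_pos by simp
  then have "(1 - l / L) ^ j * \<bar>v \<bullet> r\<bar> = \<bar>(1 - l / L) ^ j * (v \<bullet> r)\<bar>"
    by (simp add: abs_mult)
  also have "\<dots> \<le> \<bar>v \<bullet> q (iter j r)\<bar> + \<bar>p v \<bullet> iter j r\<bar>"
    unfolding * by (rule abs_triangle_ineq)
  also have "\<dots> \<le> norm v * norm (q (iter j r)) + norm (p v) * norm (iter j r)"
    by (intro add_mono Cauchy_Schwarz_ineq2)
  also have "norm (p v) * norm (iter j r) \<le> \<delta> * ((1 + M) * norm (q r))"
    using pv nr norm_iter_le_norm[of j r] \<delta>_nonneg by (intro mult_mono) auto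
  finally show "(1 - l / L) ^ j * \<bar>v \<bullet> r\<bar> \<le> norm (q (iter j r)) + \<delta> * (1 + M) * norm (q r)"
    using v by (simp add: algebra_simps)
qed

end

end

section \<open>Times to reduce the soft component\<close>

lemma minus_ln_le: "0 < x \<Longrightarrow> - ln x \<le> 1 / x - 1" for x :: real
  using ln_le_minus_one[of "1 / x"] by (simp add: ln_div)

context split_descent
begin

context
  fixes r :: 'a and M \<tau> :: real
  assumes M: "norm (p r) \<le> M * norm (q r)"
    and \<tau>: "0 < \<tau>" "\<tau> < 1"
begin

text \<open>
  Twice the number of iterations that \<open>1 - l / L\<close> needs for the factor \<open>\<tau>\<close> yields \<open>\<tau>\<^sup>2\<close>; the gap
  \<open>\<tau> - \<tau>\<^sup>2\<close> absorbs the transfer from the stiff part.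
\<close>

lemma reduction_reached:
  assumes small: "\<delta> * M \<le> \<tau> - \<tau>\<^sup>2"
  shows "\<exists>j. norm (q (iter j r)) \<le> \<tau> * norm (q r) \<and> real j \<le> 2 * (L / l) * ln (1 / \<tau>) + 1"
proof (intro exI conjI)
  define j where "j = nat \<lceil>2 * (L / l) * ln (1 / \<tau>)\<rceil>"
  have nonneg: "0 \<le> 2 * (L / l) * ln (1 / \<tau>)"
    using \<tau> l_pos L_pos by (intro mult_nonneg_nonneg) (simp_all add: ln_ge_zero)
  then show "real j \<le> 2 * (L / l) * ln (1 / \<tau>) + 1"
    by (simp add: j_def)
  have "2 * (L / l) * ln (1 / \<tau>) \<le> real j"
    unfolding j_def by (rule real_nat_ceiling_ge)
  then have "2 * ln (1 / \<tau>) \<le> real j * (l / L)"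
    using l_pos L_pos by (simp add: field_simps)
  have "(1 - l / L) ^ j \<le> exp (- (l / L)) ^ j"
    using l_le_L L_pos exp_ge_add_one_self[of "- (l / L)"] by (intro power_mono) auto
  also have "\<dots> = exp (- (real j * (l / L)))"
    by (simp flip: exp_of_nat_mult)
  also have "\<dots> \<le> exp (- (2 * ln (1 / \<tau>)))"
    using \<open>2 * ln (1 / \<tau>) \<le> real j * (l / L)\<close> by simp
  also have "\<dots> = \<tau>\<^sup>2"
    using \<tau> by (simp add: ln_div power2_eq_square exp_double flip: exp_add)
  finally have "(1 - l / L) ^ j + \<delta> * M \<le> \<tau>"
    using small by simp
  then show "norm (q (iter j r)) \<le> \<tau> * norm (q r)"
    by (rule order_trans[OF norm_q_iter_le[OF M] mult_right_mono[OF _ norm_ge_zero]])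
qed

context
  fixes j :: nat
  assumes qr: "q r \<noteq> 0" and reached: "norm (q (iter j r)) \<le> \<tau> * norm (q r)"
begin

text \<open>
  The transfer from the stiff part can at most help to get from \<open>sqrt \<tau>\<close> down to \<open>\<tau>\<close>; the soft part on
  its own has to be reduced to \<open>sqrt \<tau>\<close>, which takes half the logarithm.
\<close>

lemma reduction_time_ge:
  assumes small: "\<delta> * M \<le> sqrt \<tau> - \<tau>" and "2 * a \<le> L"
  shows "L / (4 * a) * ln (1 / \<tau>) \<le> real j"
proof -
  have "((1 - a / L) ^ j - \<delta> * M) * norm (q r) \<le> \<tau> * norm (q r)"
    using norm_q_iter_ge[OF M, of j] reached by simp
  then have "(1 - a / L) ^ j \<le> \<tau> + \<delta> * M"
    using qr by simp
  also have "\<dots> \<le> sqrt \<tau>"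
    using small by simp
  finally have le: "(1 - a / L) ^ j \<le> sqrt \<tau>" .
  have x: "0 \<le> a / L" "a / L \<le> 1 / 2"
    using assms a_pos L_pos by (auto simp: field_simps)
  have "real j * ln (1 - a / L) = ln ((1 - a / L) ^ j)"
    using x by (simp add: ln_realpow)
  also have "\<dots> \<le> ln (sqrt \<tau>)"
  proof -
    have "0 < (1 - a / L) ^ j"
      using x by (intro zero_less_power) linarith
    then show ?thesis
      using le \<tau> by (subst ln_le_cancel_iff) auto
  qed
  also have "\<dots> = - ln (1 / \<tau>) / 2"
    using \<tau> by (simp add: ln_sqrt ln_div)
  finally have "ln (1 / \<tau>) / 2 \<le> real j * (- ln (1 - a / L))"
    by simp
  also have "- ln (1 - a / L) \<le> 2 * (a / L)"
  proof -
    have "(a / L) * (a / L) \<le> (a / L) * (1 / 2)"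
      using x by (intro mult_left_mono)
    then show ?thesis
      using ln_one_minus_pos_lower_bound[OF x] by (simp add: power2_eq_square)
  qed
  finally have "ln (1 / \<tau>) / 2 \<le> real j * (2 * (a / L))"
    by (simp add: mult_left_mono)
  then show ?thesis
    using a_pos L_pos by (simp add: field_simps)
qed

text \<open>
  Taking logarithms in \<open>(1 - l/L)\<^sup>j \<bar>v \<bullet> r\<bar> \<le> (\<tau> + \<delta> (1 + M)) \<parallel>q r\<parallel>\<close> bounds \<open>j\<close> below by
  \<open>1 / (- ln (1 - l/L)) \<ge> L/l - 1\<close> times the logarithmic terms. Replacing \<open>L/l - 1\<close> by \<open>L/l\<close> costs one
  multiple of these terms. They are at most \<open>ln (1/\<tau>) + ln (1 + M)\<close>, which is where the last
  correction comes from. Both corrections are independent of \<open>r\<close> and \<open>v\<close>.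
\<close>

lemma slow_reduction_time_ge:
  assumes v: "f v = l *\<^sub>R v" "norm v = 1" "v \<bullet> r \<noteq> 0" and "0 < M" and "l < L"
  shows "L / l * (ln (1 / \<tau>) + ln (\<bar>v \<bullet> r\<bar> / norm (q r)) - ln (1 + \<delta> * (1 + M) / \<tau>)
     - (ln (1 / \<tau>) + ln (1 + M)) * (l / L)) \<le> real j"
proof -
  define X where "X = \<bar>v \<bullet> r\<bar> / norm (q r)"
  define E where "E = 1 + \<delta> * (1 + M) / \<tau>"
  define Y where "Y = ln (1 / \<tau>) + ln X - ln E"
  define Bd where "Bd = ln (1 / \<tau>) + ln (1 + M)"
  define \<theta> where "\<theta> = 1 - l / L"
  have nq: "0 < norm (q r)"
    using qr by simp
  have X: "0 < X" "X \<le> 1 + M"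
    using v nq slow_component_bounds(2)[OF M v(1,2)] by (auto simp: X_def divide_le_eq)
  have E: "1 \<le> E"
    using \<tau> \<delta>_nonneg \<open>0 < M\<close> by (simp add: E_def)
  have \<theta>: "0 < \<theta>"
    using \<open>l < L\<close> L_pos by (simp add: \<theta>_def)
  have "\<theta> ^ j * \<bar>v \<bullet> r\<bar> \<le> (\<tau> + \<delta> * (1 + M)) * norm (q r)"
    using slow_component_bounds(1)[OF M v(1,2), of j] reached by (simp add: \<theta>_def algebra_simps)
  moreover have "\<tau> + \<delta> * (1 + M) = \<tau> * E"
    using \<tau> by (simp add: E_def field_simps)
  ultimately have "\<theta> ^ j * X \<le> \<tau> * E"
    using nq by (simp add: X_def divide_le_eq)
  then have "ln (\<theta> ^ j * X) \<le> ln (\<tau> * E)"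
    using \<theta> X \<tau> E by (subst ln_le_cancel_iff) auto
  then have Y: "Y \<le> real j * (- ln \<theta>)"
    using \<theta> X \<tau> E by (simp add: Y_def ln_mult ln_realpow ln_div)
  have "- ln \<theta> \<le> 1 / \<theta> - 1"
    using \<theta> by (rule minus_ln_le)
  also have "\<dots> = l / (L - l)"
    using \<open>l < L\<close> L_pos by (simp add: \<theta>_def field_simps)
  finally have "Y \<le> real j * (l / (L - l))"
    using Y mult_left_mono[of "- ln \<theta>" "l / (L - l)" "real j"] by simp
  then have "Y * (L - l) \<le> real j * l"
    using \<open>l < L\<close> by (simp add: field_simps)
  moreover have "ln X \<le> ln (1 + M)" "0 \<le> ln E"
    using X E by auto
  then have "Y * l \<le> Bd * l"
    using l_pos by (simp add: Y_def Bd_def)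
  ultimately have "Y * L - Bd * l \<le> real j * l"
    by (simp add: algebra_simps)
  then have "(Y * L - Bd * l) / l \<le> real j"
    using l_pos by (simp add: divide_le_eq)
  moreover have "L / l * (Y - Bd * (l / L)) = (Y * L - Bd * l) / l"
    using l_pos L_pos by (simp add: field_simps)
  ultimately have "L / l * (Y - Bd * (l / L)) \<le> real j"
    by (simp only:)
  then show ?thesis
    by (simp add: Y_def X_def E_def Bd_def)
qed

end

end

end

section \<open>Hermitian matrices as self-adjoint real operators\<close>

lemma inner_eq_Re_cdot: "x \<bullet> y = Re (cdot x y)"
  by (simp add: inner_vec_def cdot_def inner_complex_def)

lemma cdot_matrix_mult: "cdot (M *v x) y = cdot x (conj_transpose M *v y)"
proof -
  have "cdot (M *v x) y = (\<Sum>i\<in>UNIV. \<Sum>j\<in>UNIV. cnj (M $ i $ j) * cnj (x $ j) * y $ i)"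
    by (simp add: cdot_def matrix_vector_mult_def sum_distrib_right)
  also have "\<dots> = (\<Sum>j\<in>UNIV. \<Sum>i\<in>UNIV. cnj (M $ i $ j) * cnj (x $ j) * y $ i)"
    by (rule sum.swap)
  also have "\<dots> = cdot x (conj_transpose M *v y)"
    by (simp add: cdot_def matrix_vector_mult_def conj_transpose_def sum_distrib_left mult_ac)
  finally show ?thesis .
qed

lemma inner_matrix_mult: "(M *v x) \<bullet> y = x \<bullet> (conj_transpose M *v y)"
  by (simp add: inner_eq_Re_cdot cdot_matrix_mult)

lemma conj_transpose_mult:
  fixes M :: "complex^'n^'m" and N :: "complex^'k^'n"
  shows "conj_transpose (M ** N) = conj_transpose N ** conj_transpose M"
  by (simp add: conj_transpose_def matrix_matrix_mult_def vec_eq_iff mult.commute)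

lemma conj_transpose_conj_transpose [simp]: "conj_transpose (conj_transpose M) = M"
  by (simp add: conj_transpose_def vec_eq_iff)

lemma of_real_scale: "complex_of_real c *s v = c *\<^sub>R v"
  by (simp add: vec_eq_iff scaleR_conv_of_real[where 'a = complex])

lemma linear_complex_matrix: "linear ((*v) (M :: complex^'n^'m))"
  by (intro linearI matrix_vector_right_distrib) (metis of_real_scale vector_scalar_commute)

lemma self_adjoint_hermitian: "conj_transpose M = M \<Longrightarrow> self_adjoint ((*v) M)"
  by (simp add: self_adjoint_def linear_complex_matrix inner_matrix_mult)

text \<open>
  Symmetry for the real part of the Hermitian product is enough, as that product is already
  nondegenerate.
\<close>

lemma hermitianI:
  assumes "\<And>x y. (M *v x) \<bullet> y = x \<bullet> (M *v y)"
  shows "conj_transpose M = M"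
proof -
  have "conj_transpose M *v y = M *v y" for y
    using assms by (metis inner_matrix_mult vector_eq_ldot)
  then show ?thesis
    by (simp add: matrix_eq)
qed

lemma hermitian_pos_def_iff:
  "hermitian_pos_def M \<longleftrightarrow> conj_transpose M = M \<and> (\<forall>x. x \<noteq> 0 \<longrightarrow> 0 < x \<bullet> (M *v x))"
  by (simp add: hermitian_pos_def_def inner_eq_Re_cdot)

lemma hermitian_spectral:
  assumes "conj_transpose M = M"
  obtains B where "spectral ((*v) M) B"
  using assms self_adjoint.orthonormal_eigenbasis_exists self_adjoint_hermitian
  by (metis spectral.intro spectral_axioms.intro)

lemma eigenvalues_eq:
  assumes "spectral ((*v) M) B"
  shows "eigenvalues M = (\<lambda>b. b \<bullet> (M *v b)) ` B"
proof -
  interpret spectral "(*v) M" B by fact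
  show ?thesis
  proof (intro equalityI subsetI)
    fix l assume "l \<in> eigenvalues M"
    then show "l \<in> (\<lambda>b. b \<bullet> (M *v b)) ` B"
      using eigenvalue_cases by (auto simp: eigenvalues_def eigenvector_def of_real_scale)
  next
    fix l assume "l \<in> (\<lambda>b. b \<bullet> (M *v b)) ` B"
    then obtain b where "b \<in> B" "l = b \<bullet> (M *v b)"
      by blast
    then have "eigenvector M l b"
      using apply_basis norm_basis by (force simp: eigenvector_def of_real_scale)
    then show "l \<in> eigenvalues M"
      by (auto simp: eigenvalues_def)
  qed
qed

lemma
  assumes "conj_transpose M = M"
  shows eigenvalues_finite: "finite (eigenvalues M)"
    and eigenvalues_nonempty: "eigenvalues M \<noteq> {}"
    and rayleigh_ge_lambda_min: "lambda_min M * (norm x)\<^sup>2 \<le> x \<bullet> (M *v x)"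
    and rayleigh_le_lambda_max: "x \<bullet> (M *v x) \<le> lambda_max M * (norm x)\<^sup>2"
proof -
  obtain B where B: "spectral ((*v) M) B"
    using assms hermitian_spectral by blast
  interpret spectral "(*v) M" B by fact
  show fin: "finite (eigenvalues M)" and "eigenvalues M \<noteq> {}"
    by (simp_all add: eigenvalues_eq[OF B] finite_basis basis_nonempty)
  have b: "lambda_min M \<le> ev b" "ev b \<le> lambda_max M" if "b \<in> B" for b
    using fin that by (auto simp: lambda_min_def lambda_max_def eigenvalues_eq[OF B])
  show "lambda_min M * (norm x)\<^sup>2 \<le> x \<bullet> (M *v x)" "x \<bullet> (M *v x) \<le> lambda_max M * (norm x)\<^sup>2"
    unfolding rayleigh[of x] norm_sq sum_distrib_left
    by (auto intro!: sum_mono mult_right_mono b)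
qed

lemma extreme_eigenvalues_attained:
  assumes "conj_transpose M = M"
  shows "\<exists>v. eigenvector M (lambda_min M) v" "\<exists>v. eigenvector M (lambda_max M) v"
  using eigenvalues_finite[OF assms] eigenvalues_nonempty[OF assms] Min_in Max_in
  unfolding lambda_min_def lambda_max_def eigenvalues_def by blast+

lemma eigenvector_rayleigh:
  "eigenvector M l v \<Longrightarrow> v \<bullet> (M *v v) = l * (norm v)\<^sup>2"
  by (simp add: eigenvector_def of_real_scale power2_norm_eq_inner)

lemma lambda_min_ge:
  assumes "conj_transpose M = M" "\<And>x. c * (norm x)\<^sup>2 \<le> x \<bullet> (M *v x)"
  shows "c \<le> lambda_min M"
proof -
  obtain v where "eigenvector M (lambda_min M) v"
    using assms extreme_eigenvalues_attained by blast
  then have "v \<noteq> 0" "c * (norm v)\<^sup>2 \<le> lambda_min M * (norm v)\<^sup>2"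
    using assms(2)[of v] eigenvector_rayleigh[of M _ v] by (auto simp: eigenvector_def)
  then show ?thesis
    by simp
qed

lemma lambda_max_le:
  assumes "conj_transpose M = M" "\<And>x. x \<bullet> (M *v x) \<le> c * (norm x)\<^sup>2"
  shows "lambda_max M \<le> c"
proof -
  obtain v where "eigenvector M (lambda_max M) v"
    using assms extreme_eigenvalues_attained by blast
  then have "v \<noteq> 0" "lambda_max M * (norm v)\<^sup>2 \<le> c * (norm v)\<^sup>2"
    using assms(2)[of v] eigenvector_rayleigh[of M _ v] by (auto simp: eigenvector_def)
  then show ?thesis
    by simp
qed

lemma lambda_min_pos: "hermitian_pos_def M \<Longrightarrow> 0 < lambda_min M"
  using extreme_eigenvalues_attained[of M] eigenvector_rayleigh[of M]
  by (metis eigenvector_def hermitian_pos_def_iff zero_less_mult_pos2 zero_less_norm_iff zero_less_power)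

section \<open>Inverse square roots\<close>

context spectral
begin

text \<open>
  The operator \<open>\<phi>(f)\<close>, defined by letting it act as \<open>\<phi> \<lambda>\<close> on the eigenspace of \<open>\<lambda>\<close>.
\<close>

definition functional_calculus :: "(real \<Rightarrow> real) \<Rightarrow> 'a \<Rightarrow> 'a" where
  "functional_calculus \<phi> x = (\<Sum>b\<in>B. (\<phi> (ev b) * (x \<bullet> b)) *\<^sub>R b)"

lemma functional_calculus_coeff:
  assumes "b \<in> B" shows "functional_calculus \<phi> x \<bullet> b = \<phi> (ev b) * (x \<bullet> b)"
proof -
  have orth: "c \<bullet> b = (if c = b then 1 else 0)" if "c \<in> B" for c
    using basis that assms
    by (auto simp: orthonormal_eigenbasis_def pairwise_def orthogonal_def dot_square_norm)
  have "functional_calculus \<phi> x \<bullet> b = (\<Sum>c\<in>B. if c = b then \<phi> (ev c) * (x \<bullet> c) else 0)"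
    unfolding functional_calculus_def inner_sum_left by (intro sum.cong) (simp_all add: orth)
  then show ?thesis
    using assms by (simp add: finite_basis)
qed

lemma eq_by_coeff: "(\<And>b. b \<in> B \<Longrightarrow> x \<bullet> b = y \<bullet> b) \<Longrightarrow> x = y"
  using coeff_neq_0[of "x - y"] by (auto simp: inner_diff_left)

lemma linear_functional_calculus: "linear (functional_calculus \<phi>)"
  by (intro linearI eq_by_coeff) (simp_all add: functional_calculus_coeff inner_add_left algebra_simps)

lemma functional_calculus_eigenvector:
  assumes "f y = l *\<^sub>R y"
  shows "functional_calculus \<phi> y = \<phi> l *\<^sub>R y"
proof (rule eq_by_coeff)
  fix b assume b: "b \<in> B"
  have "ev b = l" if "y \<bullet> b \<noteq> 0"
    using apply_coeff[OF b, of y] that assms by simp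
  then show "functional_calculus \<phi> y \<bullet> b = (\<phi> l *\<^sub>R y) \<bullet> b"
    using b by (cases "y \<bullet> b = 0") (simp_all add: functional_calculus_coeff)
qed

text \<open>
  A map that commutes with \<open>f\<close> preserves its eigenspaces. The case of multiplication by a complex
  scalar shows that \<open>\<phi>(f)\<close> is complex linear, hence a matrix, although the eigenbasis is only a real
  one.
\<close>

lemma functional_calculus_commute:
  assumes h: "linear h" "\<And>x. f (h x) = h (f x)"
  shows "functional_calculus \<phi> (h x) = h (functional_calculus \<phi> x)"
proof -
  have "functional_calculus \<phi> (h b) = \<phi> (ev b) *\<^sub>R h b" if "b \<in> B" for b
    using h(2)[of b] apply_basis[OF that] linear_scale[OF h(1)]
    by (intro functional_calculus_eigenvector) metis
  moreover have "h x = (\<Sum>b\<in>B. (x \<bullet> b) *\<^sub>R h b)"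
    by (subst expansion[of x, symmetric]) (simp add: h linear_sum linear_scale)
  ultimately have "functional_calculus \<phi> (h x) = (\<Sum>b\<in>B. (x \<bullet> b) *\<^sub>R \<phi> (ev b) *\<^sub>R h b)"
    by (simp add: linear_sum[OF linear_functional_calculus] linear_scale[OF linear_functional_calculus])
  also have "\<dots> = h (functional_calculus \<phi> x)"
    by (simp add: functional_calculus_def h linear_sum linear_scale mult.commute)
  finally show ?thesis .
qed

end

lemma inverse_square_root_exists:
  assumes "hermitian_pos_def M"
  obtains R where "hermitian_pos_def R" "R ** R ** M = mat 1"
proof -
  have M: "conj_transpose M = M"
    using assms by (simp add: hermitian_pos_def_def)
  obtain B where "spectral ((*v) M) B"
    using hermitian_spectral[OF M] by blast
  then interpret spectral "(*v) M" B .
  let ?g = "functional_calculus (\<lambda>t. 1 / sqrt t)"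
  have pos: "0 < ev b" if "b \<in> B" for b
  proof -
    have "b \<noteq> 0"
      using norm_basis[OF that] by auto
    then show ?thesis
      using assms by (simp add: hermitian_pos_def_iff)
  qed
  have "Vector_Spaces.linear (*s) (*s) ?g"
  proof (intro Vector_Spaces.linear_iff[THEN iffD2] conjI allI)
    show "?g (x + y) = ?g x + ?g y" for x y
      by (rule linear_add[OF linear_functional_calculus])
    show "?g (c *s x) = c *s ?g x" for c x
    proof (rule functional_calculus_commute)
      show "linear ((*s) c :: complex^'a \<Rightarrow> _)"
        by (intro linearI) (simp_all add: vec_eq_iff algebra_simps)
      show "M *v (c *s x) = c *s (M *v x)" for x
        by (rule vector_scalar_commute)
    qed
  qed unfold_locales
  then have g: "matrix ?g *v x = ?g x" for x
    by (rule matrix_works)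
  have "?g x \<bullet> y = x \<bullet> ?g y" for x y
    unfolding parseval[of "?g x" y] parseval[of x "?g y"]
    by (intro sum.cong) (simp_all add: functional_calculus_coeff)
  then have "conj_transpose (matrix ?g) = matrix ?g"
    by (intro hermitianI) (simp add: g)
  moreover have "0 < x \<bullet> (matrix ?g *v x)" if nz: "x \<noteq> 0" for x
  proof -
    obtain b where b: "b \<in> B" "x \<bullet> b \<noteq> 0"
      using coeff_neq_0[OF nz] by blast
    have "0 < (\<Sum>c\<in>B. (x \<bullet> c) * (?g x \<bullet> c))"
    proof (rule sum_pos2[OF finite_basis b(1)])
      show "0 < (x \<bullet> b) * (?g x \<bullet> b)"
        using b pos[OF b(1)] by (simp add: functional_calculus_coeff flip: power2_eq_square)
      show "0 \<le> (x \<bullet> c) * (?g x \<bullet> c)" if "c \<in> B" for c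
        using that pos[OF that] by (simp add: functional_calculus_coeff zero_le_mult_iff)
    qed
    then show ?thesis
      by (simp only: g flip: parseval)
  qed
  moreover have "matrix ?g ** matrix ?g ** M = mat 1"
  proof -
    have "?g (?g (M *v x)) = x" for x
    proof (rule eq_by_coeff)
      fix b assume "b \<in> B"
      then show "?g (?g (M *v x)) \<bullet> b = x \<bullet> b"
        using pos[of b] by (simp add: functional_calculus_coeff apply_coeff)
    qed
    then show ?thesis
      by (simp add: matrix_eq g flip: matrix_vector_mul_assoc)
  qed
  ultimately show thesis
    using that[of "matrix ?g"] by (simp add: hermitian_pos_def_iff)
qed

text \<open>
  If \<open>T b = \<mu> b\<close>, then \<open>0 = (R\<^sup>2 - \<mu>\<^sup>2) b = (R + \<mu>) (R - \<mu>) b\<close>. As \<open>R + \<mu>\<close> is positive definite, it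
  follows that \<open>R b = \<mu> b\<close>.
\<close>

lemma square_root_unique:
  assumes R: "hermitian_pos_def R" and T: "hermitian_pos_def T" and eq: "R ** R = T ** T"
  shows "R = T"
proof -
  have "conj_transpose T = T"
    using T by (simp add: hermitian_pos_def_def)
  then obtain B where "spectral ((*v) T) B"
    using hermitian_spectral by blast
  then interpret spectral "(*v) T" B .
  note lin = linear_scale[OF linear_complex_matrix] linear_diff[OF linear_complex_matrix]
  have "R *v b = T *v b" if b: "b \<in> B" for b
  proof -
    define y where "y = R *v b - ev b *\<^sub>R b"
    have "b \<noteq> 0"
      using norm_basis[OF b] by auto
    then have ev: "0 < ev b"
      using T by (simp add: hermitian_pos_def_iff)
    have "R *v (R *v b) = T *v (T *v b)"
      by (simp add: matrix_vector_mul_assoc eq)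
    also have "\<dots> = ev b *\<^sub>R ev b *\<^sub>R b"
      using apply_basis[OF b] by (metis linear linear_scale)
    finally have "R *v y + ev b *\<^sub>R y = 0"
      by (simp add: y_def lin scaleR_diff_right)
    then have "y \<bullet> (R *v y) = - (ev b * (y \<bullet> y))"
      by (metis add_eq_0_iff2 inner_minus_right inner_scaleR_right)
    then have "\<not> 0 < y \<bullet> (R *v y)"
      using ev by (simp add: not_less)
    then have "y = 0"
      using R unfolding hermitian_pos_def_iff by blast
    then show ?thesis
      using apply_basis[OF b] by (simp add: y_def)
  qed
  then have "R *v x = T *v x" for x
    using linear_eq_on_span[OF linear_complex_matrix linear_complex_matrix, of B R T x] basis
    by (auto simp: orthonormal_eigenbasis_def)
  then show ?thesis
    by (simp add: matrix_eq)
qed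

lemma matrix_inv_eq:
  fixes M N :: "'a::field^'n^'n"
  assumes "N ** M = mat 1"
  shows "matrix_inv M = N"
  unfolding matrix_inv_def
proof (rule some_equality)
  show "M ** N = mat 1 \<and> N ** M = mat 1"
    using assms matrix_left_right_inverse by blast
  show "P = N" if "M ** P = mat 1 \<and> P ** M = mat 1" for P
    by (metis assms matrix_mul_assoc matrix_mul_lid matrix_mul_rid that)
qed

lemma inv_sqrt:
  assumes "hermitian_pos_def M"
  shows "hermitian_pos_def (inv_sqrt M)" "inv_sqrt M ** M ** inv_sqrt M = mat 1"
proof -
  obtain R where R: "hermitian_pos_def R" "R ** R ** M = mat 1"
    using inverse_square_root_exists assms by blast
  then have sq: "R ** R = matrix_inv M"
    by (simp add: matrix_inv_eq)
  then have "inv_sqrt M = R"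
    unfolding inv_sqrt_def
  proof (intro the_equality)
    show "T = R" if "hermitian_pos_def T \<and> T ** T = matrix_inv M" for T
      by (rule square_root_unique) (simp_all add: that R sq)
  qed (simp add: R sq)
  moreover have "R ** M ** R = mat 1"
    using R(2) by (metis matrix_left_right_inverse matrix_mul_assoc)
  ultimately show "hermitian_pos_def (inv_sqrt M)" "inv_sqrt M ** M ** inv_sqrt M = mat 1"
    using R by simp_all
qed

section \<open>The coupling of the two blocks\<close>

text \<open>
  Extension by zero outside the range of \<open>f\<close>. For injective \<open>f\<close> only one summand can be nonzero; the
  sum avoids a choice of an inverse of \<open>f\<close>.
\<close>

definition embed :: "('a::finite \<Rightarrow> 'n::finite) \<Rightarrow> complex^'a \<Rightarrow> complex^'n" where
  "embed f x = (\<chi> n. \<Sum>i\<in>UNIV. if f i = n then x $ i else 0)"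

lemma embed_adjoint: "embed f x \<bullet> y = x \<bullet> subvec f y"
proof -
  have "embed f x \<bullet> y = (\<Sum>n\<in>UNIV. \<Sum>i\<in>UNIV. (if f i = n then x $ i else 0) \<bullet> y $ n)"
    by (simp add: inner_vec_def embed_def inner_sum_left)
  also have "\<dots> = (\<Sum>i\<in>UNIV. \<Sum>n\<in>UNIV. (if f i = n then x $ i \<bullet> y $ n else 0))"
    by (subst sum.swap) (intro sum.cong; simp)
  also have "\<dots> = x \<bullet> subvec f y"
    by (simp add: inner_vec_def subvec_def)
  finally show ?thesis .
qed

lemma subvec_embed: "inj f \<Longrightarrow> subvec f (embed f x) = x"
  by (simp add: subvec_def embed_def vec_eq_iff inj_eq)

lemma subvec_embed_disjoint: "range f \<inter> range g = {} \<Longrightarrow> subvec f (embed g x) = 0"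
  unfolding subvec_def embed_def by (auto simp: vec_eq_iff intro!: sum.neutral) (metis IntI emptyE rangeI)

lemma subvec_mult_embed: "subvec f (M *v embed g x) = block f g M *v x"
proof -
  have "(\<Sum>n\<in>UNIV. M $ f i $ n * (\<Sum>j\<in>UNIV. if g j = n then x $ j else 0))
      = (\<Sum>j\<in>UNIV. M $ f i $ g j * x $ j)" for i
    unfolding sum_distrib_left by (subst sum.swap) (simp add: if_distrib cong: if_cong)
  then show ?thesis
    by (simp add: subvec_def embed_def block_def matrix_vector_mult_def vec_eq_iff)
qed

lemma subvec_diff: "subvec f (x - y) = subvec f x - subvec f y"
  by (simp add: subvec_def vec_eq_iff)

lemma block_hermitian_pos_def:
  assumes M: "hermitian_pos_def M" and f: "inj f"
  shows "hermitian_pos_def (block f f M)"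
proof -
  have "conj_transpose M $ i $ j = M $ i $ j" for i j
    using M by (simp add: hermitian_pos_def_def)
  then have "cnj (M $ j $ i) = M $ i $ j" for i j
    by (simp add: conj_transpose_def)
  then have "conj_transpose (block f f M) = block f f M"
    by (simp add: conj_transpose_def block_def)
  moreover have "0 < x \<bullet> (block f f M *v x)" if "x \<noteq> 0" for x
  proof -
    have "embed f x \<noteq> 0"
      using subvec_embed[OF f, of x] that by (metis inner_eq_zero_iff inner_zero_left embed_adjoint)
    then have "0 < embed f x \<bullet> (M *v embed f x)"
      using M by (simp add: hermitian_pos_def_iff)
    then show ?thesis
      by (simp add: embed_adjoint subvec_mult_embed)
  qed
  ultimately show ?thesis
    by (simp add: hermitian_pos_def_iff)
qed

lemma sandwich:
  assumes "conj_transpose R = R"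
  shows "(R *v u) \<bullet> (N *v (T *v y)) = u \<bullet> ((R ** N ** T) *v y)"
  by (simp add: inner_matrix_mult assms matrix_vector_mul_assoc matrix_mul_assoc)

text \<open>
  Write \<open>X\<close> for the matrix whose norm is \<open>\<rho>\<close>. Evaluating the positive definite form of \<open>K\<close> at the
  vector with the blocks \<open>- K\<^sub>C\<^sub>C\<^sup>-\<^sup>1\<^sup>/\<^sup>2 X y\<close> and \<open>K\<^sub>D\<^sub>D\<^sup>-\<^sup>1\<^sup>/\<^sup>2 y\<close> gives \<open>\<parallel>y\<parallel>\<^sup>2 - \<parallel>X y\<parallel>\<^sup>2\<close>. So \<open>X\<close> shortens every
  nonzero vector, and since the unit sphere is compact it does so by a uniform factor.
\<close>

theorem rho_less_1:
  assumes K: "hermitian_pos_def K" and iC: "inj iC" and iD: "inj iD"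
    and disj: "range iC \<inter> range iD = {}"
  shows "rho iC iD K < 1"
proof -
  define RC where "RC = inv_sqrt (block iC iC K)"
  define RD where "RD = inv_sqrt (block iD iD K)"
  define X where "X = RC ** block iC iD K ** RD"
  have RC: "conj_transpose RC = RC" "RC ** block iC iC K ** RC = mat 1"
    using inv_sqrt[OF block_hermitian_pos_def[OF K iC]] by (simp_all add: RC_def hermitian_pos_def_def)
  have RD: "conj_transpose RD = RD" "RD ** block iD iD K ** RD = mat 1"
    using inv_sqrt[OF block_hermitian_pos_def[OF K iD]] by (simp_all add: RD_def hermitian_pos_def_def)
  have less: "norm (X *v y) < norm y" if "y \<noteq> 0" for y
  proof -
    define u where "u = X *v y"
    define x where "x = RC *v u"
    define z where "z = RD *v y"
    define w where "w = embed iD z - embed iC x"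
    have "(RD ** block iD iD K) *v z = y"
      by (simp add: z_def matrix_vector_mul_assoc RD)
    then have "z \<noteq> 0"
      using that by auto
    moreover have "subvec iD w = z"
      using disj by (simp add: w_def subvec_diff subvec_embed[OF iD] subvec_embed_disjoint Int_commute)
    ultimately have "w \<noteq> 0"
      by (metis cancel_comm_monoid_add_class.diff_cancel subvec_diff)
    then have "0 < w \<bullet> (K *v w)"
      using K by (simp add: hermitian_pos_def_iff)
    also have "\<dots> = z \<bullet> (block iD iD K *v z) - 2 * (x \<bullet> (block iC iD K *v z)) + x \<bullet> (block iC iC K *v x)"
    proof -
      have "embed iD z \<bullet> (K *v embed iC x) = embed iC x \<bullet> (K *v embed iD z)"
        using K inner_matrix_mult[of K "embed iD z" "embed iC x"]
        by (simp add: hermitian_pos_def_def inner_commute)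
      then show ?thesis
        by (simp add: w_def matrix_vector_mult_diff_distrib inner_diff_left inner_diff_right
            embed_adjoint subvec_mult_embed)
    qed
    also have "z \<bullet> (block iD iD K *v z) = (norm y)\<^sup>2"
      by (simp add: z_def sandwich RD power2_norm_eq_inner)
    also have "x \<bullet> (block iC iC K *v x) = (norm u)\<^sup>2"
      by (simp add: x_def sandwich RC power2_norm_eq_inner)
    also have "x \<bullet> (block iC iD K *v z) = (norm u)\<^sup>2"
      by (simp add: x_def z_def sandwich RC X_def[symmetric] u_def[symmetric] power2_norm_eq_inner)
    finally have "(norm u)\<^sup>2 < (norm y)\<^sup>2"
      by simp
    then show ?thesis
      unfolding u_def by (rule power2_less_imp_less) simp
  qed
  let ?S = "sphere 0 1 :: (complex^'c) set"
  have "continuous_on ?S (\<lambda>y. norm (X *v y))"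
    by (intro continuous_on_norm linear_continuous_on linear_linear[THEN iffD1] linear_complex_matrix)
       (simp add: linear_complex_matrix linear_conv_bounded_linear[symmetric])
  moreover have "?S \<noteq> {}"
    by simp
  ultimately obtain y0 where y0: "norm y0 = 1" and max: "\<And>y. norm y = 1 \<Longrightarrow> norm (X *v y) \<le> norm (X *v y0)"
    using continuous_attains_sup[of ?S "\<lambda>y. norm (X *v y)"] by auto
  have "onorm ((*v) X) \<le> norm (X *v y0)"
  proof (rule onorm_bound)
    fix y :: "complex^'c"
    show "norm (X *v y) \<le> norm (X *v y0) * norm y"
    proof (cases "y = 0")
      case False
      have "norm (X *v (y /\<^sub>R norm y)) \<le> norm (X *v y0)"
        using False by (intro max) simp
      then show ?thesis
        using False by (simp add: linear_scale[OF linear_complex_matrix] field_simps)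
    qed simp
  qed simp
  also have "\<dots> < 1"
    using less[of y0] y0 by fastforce
  finally show ?thesis
    by (simp add: rho_def spectral_norm_def X_def RC_def RD_def)
qed

section \<open>The quadratic form of the system matrix\<close>

lemma norm_complex_smult: "norm (c *s x :: complex^'n) = cmod c * norm x"
  by (simp add: norm_vec_def L2_set_def norm_mult power_mult_distrib real_sqrt_mult flip: sum_distrib_left)

lemma coord_proj_mult: "(coord_proj C *v x) $ i = (if i \<in> C then x $ i else 0)"
proof -
  have "(coord_proj C *v x) $ i = (\<Sum>j\<in>UNIV. if j = i then (if i \<in> C then x $ i else 0) else 0)"
    unfolding coord_proj_def matrix_vector_mult_def vec_lambda_beta by (intro sum.cong) auto
  then show ?thesis
    by simp
qed

lemma coord_proj_eq_embed:
  assumes "bij_betw f UNIV C"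
  shows "coord_proj C *v x = embed f (subvec f x)"
proof -
  have inj: "inj f" and C: "C = range f"
    using assms by (auto simp: bij_betw_def)
  have "(\<Sum>i\<in>UNIV. if f i = n then x $ f i else 0) = (if n \<in> C then x $ n else 0)" for n
  proof (cases "n \<in> C")
    case True
    then obtain k where "n = f k"
      using C by blast
    then show ?thesis
      using True inj by (simp add: inj_eq)
  qed (auto simp: C intro!: sum.neutral)
  then show ?thesis
    by (simp add: vec_eq_iff coord_proj_mult embed_def subvec_def cong: if_cong)
qed

lemma norm_coord_proj:
  assumes "bij_betw f UNIV C"
  shows "norm (coord_proj C *v x) = norm (subvec f x)"
proof -
  have "inj f"
    using assms by (simp add: bij_betw_def)
  then have "embed f y \<bullet> embed f y = y \<bullet> y" for y
    by (simp add: embed_adjoint subvec_embed)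
  then show ?thesis
    by (simp add: coord_proj_eq_embed[OF assms] norm_eq_sqrt_inner)
qed

lemma conj_transpose_coord_proj: "conj_transpose (coord_proj C) = coord_proj C"
  by (auto simp: conj_transpose_def coord_proj_def vec_eq_iff)

lemma coord_proj_adjoint: "(coord_proj C *v x) \<bullet> y = x \<bullet> (coord_proj C *v y)"
  by (simp add: inner_matrix_mult conj_transpose_coord_proj)

lemma coord_proj_idem: "coord_proj C *v (coord_proj C *v x) = coord_proj C *v x"
  by (simp add: vec_eq_iff coord_proj_mult)

lemma coord_proj_complement:
  assumes "C \<union> D = UNIV" "C \<inter> D = {}"
  shows "x - coord_proj C *v x = coord_proj D *v x"
  using assms by (auto simp: vec_eq_iff coord_proj_mult)

lemma norm_coord_proj_le: "norm (coord_proj C *v x) \<le> norm x"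
  unfolding norm_vec_def by (intro L2_set_mono) (auto simp: coord_proj_mult)

lemma A_hat_adjoint_mult:
  "conj_transpose (A_hat S C \<xi> b) *v x =
     conj_transpose S *v x - (\<i> * complex_of_real (b * \<xi>)) *s (coord_proj C *v x)"
proof -
  have smult: "mat c *v y = c *s y" for c :: complex and y :: "complex^'a"
    by (simp add: mat_def matrix_vector_mult_def vec_eq_iff if_distrib if_distribR cong: if_cong)
  have "conj_transpose (mat c :: complex^'a^'a) = mat (cnj c)" for c
    by (auto simp: conj_transpose_def mat_def vec_eq_iff)
  moreover have "conj_transpose (M + N) = conj_transpose M + conj_transpose N" for M N :: "complex^'a^'a"
    by (simp add: conj_transpose_def vec_eq_iff)
  ultimately have "conj_transpose (A_hat S C \<xi> b) *v x =
      conj_transpose S *v x + coord_proj C *v (- (\<i> * complex_of_real (b * \<xi>)) *s x)"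
    by (simp add: A_hat_def conj_transpose_mult conj_transpose_coord_proj matrix_vector_mult_add_rdistrib
        smult flip: matrix_vector_mul_assoc)
  also have "coord_proj C *v (- (\<i> * complex_of_real (b * \<xi>)) *s x) =
      - ((\<i> * complex_of_real (b * \<xi>)) *s (coord_proj C *v x))"
    by (simp add: vec_eq_iff coord_proj_mult)
  finally show ?thesis
    by simp
qed

lemma G_mat_hermitian:
  "conj_transpose K = K \<Longrightarrow> conj_transpose (G_mat S K C \<xi> b) = G_mat S K C \<xi> b"
  by (simp add: G_mat_def conj_transpose_mult matrix_mul_assoc)

lemma G_mat_form:
  "x \<bullet> (G_mat S K C \<xi> b *v x) =
     (conj_transpose (A_hat S C \<xi> b) *v x) \<bullet> (K *v (conj_transpose (A_hat S C \<xi> b) *v x))"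
  by (simp add: G_mat_def inner_matrix_mult matrix_vector_mul_assoc matrix_mul_assoc)

lemma matrix_norm_bound:
  fixes M :: "complex^'n^'m"
  shows "\<exists>s>0. \<forall>x. norm (M *v x) \<le> s * norm x"
  using bounded_linear.pos_bounded[of "(*v) M"] linear_complex_matrix[of M]
  by (auto simp: linear_conv_bounded_linear mult.commute)

text \<open>
  On vectors supported on \<open>D\<close> the \<open>D\<close>-block of \<open>S\<^sup>H\<close> acts as \<open>S\<^sub>D\<^sub>D\<^sup>H\<close>, which has a bounded inverse.
\<close>

lemma invertible_block_lower_bound:
  assumes D: "bij_betw iD UNIV D" and S: "invertible (block iD iD S)"
  shows "\<exists>t>0. \<forall>x. norm (coord_proj D *v x)
    \<le> t * norm (coord_proj D *v (conj_transpose S *v (coord_proj D *v x)))"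
proof -
  let ?T = "block iD iD (conj_transpose S)"
  have T: "?T = conj_transpose (block iD iD S)"
    by (simp add: block_def conj_transpose_def)
  obtain N where "block iD iD S ** N = mat 1"
    using S by (auto simp: invertible_def)
  then have "conj_transpose N ** ?T = mat 1"
    unfolding T by (simp flip: conj_transpose_mult) (simp add: conj_transpose_def mat_def vec_eq_iff)
  then have N: "conj_transpose N *v (?T *v z) = z" for z
    by (simp add: matrix_vector_mul_assoc)
  obtain t where "0 < t" and t: "norm (conj_transpose N *v z) \<le> t * norm z" for z
    using matrix_norm_bound by blast
  have "norm (coord_proj D *v x) \<le> t * norm (coord_proj D *v (conj_transpose S *v (coord_proj D *v x)))" for x
    using t[of "?T *v subvec iD x"] unfolding N norm_coord_proj[OF D]
    by (simp add: coord_proj_eq_embed[OF D] subvec_mult_embed)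
  then show ?thesis
    using \<open>0 < t\<close> by blast
qed

text \<open>
  Let \<open>y = A\<^sup>H x\<close>. Its \<open>C\<close>-block shows that \<open>b \<bar>\<xi>\<bar> \<parallel>x\<^sub>C\<parallel> \<le> \<parallel>y\<parallel> + s \<parallel>x\<parallel>\<close>, and its \<open>D\<close>-block, through the
  invertibility of \<open>S\<^sub>D\<^sub>D\<close>, that \<open>\<parallel>x\<^sub>D\<parallel> \<le> t (\<parallel>y\<parallel> + s \<parallel>x\<^sub>C\<parallel>)\<close>. For large \<open>b\<close> the first estimate makes the
  contribution of \<open>x\<^sub>C\<close> to \<open>\<parallel>x\<parallel>\<close> at most \<open>\<parallel>x\<parallel> / 2\<close> plus a multiple of \<open>\<parallel>y\<parallel>\<close>, so \<open>\<parallel>x\<parallel>\<close> is controlled by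
  \<open>\<parallel>y\<parallel>\<close>; put back into the first estimate this controls \<open>b \<parallel>x\<^sub>C\<parallel>\<close>.
\<close>

lemma A_hat_adjoint_lower_bounds:
  assumes partition: "C \<union> D = UNIV" "C \<inter> D = {}"
    and D: "bij_betw iD UNIV D" and S_DD: "invertible (block iD iD S)" and xi: "\<xi> \<noteq> 0"
  obtains m b0 where "0 < m" "0 < b0"
    "\<And>b x. b0 \<le> b \<Longrightarrow> norm x \<le> m * norm (conj_transpose (A_hat S C \<xi> b) *v x)"
    "\<And>b x. b0 \<le> b \<Longrightarrow>
       b * norm (coord_proj C *v x) \<le> m * norm (conj_transpose (A_hat S C \<xi> b) *v x)"
proof -
  obtain s where s: "0 < s" "\<And>x. norm (conj_transpose S *v x) \<le> s * norm x"
    using matrix_norm_bound by blast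
  obtain t where t: "0 < t" "\<And>x. norm (coord_proj D *v x)
      \<le> t * norm (coord_proj D *v (conj_transpose S *v (coord_proj D *v x)))"
    using invertible_block_lower_bound[OF D S_DD] by blast
  \<comment> \<open>For \<open>b \<ge> b0\<close> the factor \<open>(1 + t s) s / (b \<bar>\<xi>\<bar>)\<close> of \<open>\<parallel>x\<parallel>\<close> in the combined estimate is at most \<open>1 / 2\<close>.\<close>
  define m where "m = 1 / s + 2 * t"
  define b0 where "b0 = 2 * s * (1 + t * s) / \<bar>\<xi>\<bar>"
  have m: "0 < m" and b0: "0 < b0"
    using s t xi by (auto simp: m_def b0_def add_pos_pos)
  have "norm x \<le> m * norm y \<and> \<bar>\<xi>\<bar> * (b * norm (coord_proj C *v x)) \<le> (1 + s * m) * norm y"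
    if b: "b0 \<le> b" and y: "y = conj_transpose (A_hat S C \<xi> b) *v x" for b x y
  proof -
    let ?P = "(*v) (coord_proj C) :: complex^'a \<Rightarrow> _" and ?Q = "(*v) (coord_proj D) :: complex^'a \<Rightarrow> _"
    let ?S = "(*v) (conj_transpose S)"
    define \<beta> where "\<beta> = \<bar>\<xi>\<bar> * b"
    have "0 < b"
      using b b0 by simp
    then have \<beta>: "2 * s * (1 + t * s) \<le> \<beta>" "0 < \<beta>" "cmod (\<i> * complex_of_real (b * \<xi>)) = \<beta>"
      using b xi by (auto simp: \<beta>_def b0_def field_simps norm_mult abs_mult)
    have "(\<i> * complex_of_real (b * \<xi>)) *s ?P x = ?S x - y"
      by (simp add: y A_hat_adjoint_mult)
    then have "\<beta> * norm (?P x) = norm (?S x - y)"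
      by (metis \<beta>(3) norm_complex_smult)
    also have "\<dots> \<le> norm (?S x) + norm y"
      by (rule norm_triangle_ineq4)
    finally have P: "\<beta> * norm (?P x) \<le> s * norm x + norm y"
      using s(2)[of x] by simp
    have x: "x = ?P x + ?Q x"
      by (simp flip: coord_proj_complement[OF partition])
    have "?Q (?P z) = 0" for z
      using partition by (auto simp: vec_eq_iff coord_proj_mult)
    then have "?Q y = ?Q (?S x)"
      unfolding y A_hat_adjoint_mult
      by (simp add: matrix_vector_mult_diff_distrib vector_scalar_commute)
    also have "?S x = ?S (?P x) + ?S (?Q x)"
      by (metis matrix_vector_right_distrib x)
    finally have "?Q (?S (?Q x)) = ?Q y - ?Q (?S (?P x))"
      by (simp add: matrix_vector_right_distrib)
    then have "norm (?Q (?S (?Q x))) \<le> norm (?Q y) + norm (?Q (?S (?P x)))"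
      by (simp add: norm_triangle_ineq4)
    also have "\<dots> \<le> norm y + s * norm (?P x)"
      using norm_coord_proj_le s(2) order_trans by (intro add_mono) blast+
    finally have "norm (?Q x) \<le> t * (norm y + s * norm (?P x))"
      using t(2)[of x] mult_left_mono[of _ _ t] t(1) by (meson less_imp_le order_trans)
    then have "norm x \<le> norm (?P x) + t * (norm y + s * norm (?P x))"
      using x norm_triangle_ineq[of "?P x" "?Q x"] by simp
    then have "norm x \<le> (1 + t * s) * norm (?P x) + t * norm y"
      by (simp add: algebra_simps)
    moreover have "2 * s * ((1 + t * s) * norm (?P x)) \<le> s * norm x + norm y"
      using mult_right_mono[OF \<beta>(1) norm_ge_zero[of "?P x"]] P by (simp add: algebra_simps)
    ultimately have "2 * s * norm x \<le> s * norm x + norm y + 2 * s * (t * norm y)"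
      using mult_left_mono[of "norm x" "(1 + t * s) * norm (?P x) + t * norm y" "2 * s"] s(1)
      by (simp add: algebra_simps)
    then have nx: "norm x \<le> m * norm y"
      using s(1) by (simp add: m_def field_simps)
    then have "s * norm x \<le> s * (m * norm y)"
      using s(1) by simp
    then have "\<beta> * norm (?P x) \<le> (1 + s * m) * norm y"
      using P by (simp add: algebra_simps)
    then show ?thesis
      using nx by (simp add: \<beta>_def algebra_simps)
  qed
  note bounds = this
  define m' where "m' = max m ((1 + s * m) / \<bar>\<xi>\<bar>)"
  have final: "norm x \<le> m' * norm y \<and> b * norm (coord_proj C *v x) \<le> m' * norm y"
    if "b0 \<le> b" "y = conj_transpose (A_hat S C \<xi> b) *v x" for b x y
  proof
    show "norm x \<le> m' * norm y"
      using bounds[OF that] mult_right_mono[of m m' "norm y"] by (simp add: m'_def)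
    have "b * norm (coord_proj C *v x) \<le> (1 + s * m) / \<bar>\<xi>\<bar> * norm y"
      using bounds[OF that] xi by (simp add: field_simps)
    also have "\<dots> \<le> m' * norm y"
      by (intro mult_right_mono) (simp_all add: m'_def)
    finally show "b * norm (coord_proj C *v x) \<le> m' * norm y" .
  qed
  have "0 < m'"
    using m by (simp add: m'_def)
  show thesis
    by (rule that[OF \<open>0 < m'\<close> b0]) (use final in blast)+
qed

text \<open>
  Since \<open>x \<bullet> G x = y \<bullet> K y\<close> for \<open>y = A\<^sup>H x\<close>, the form is comparable to \<open>\<parallel>y\<parallel>\<^sup>2\<close>. For \<open>x\<close> supported on \<open>D\<close>
  the vector \<open>y = S\<^sup>H x\<close> does not depend on \<open>b\<close>.
\<close>

lemma G_mat_estimates: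
  assumes partition: "C \<union> D = UNIV" "C \<inter> D = {}"
    and D: "bij_betw iD UNIV D" and S_DD: "invertible (block iD iD S)" and xi: "\<xi> \<noteq> 0"
    and K: "hermitian_pos_def K"
  obtains l0 c a h b0 where "0 < l0" "0 < c" "0 < a" "0 < h" "0 < b0"
    "\<And>b x. b0 \<le> b \<Longrightarrow> l0 * (norm x)\<^sup>2 \<le> x \<bullet> (G_mat S K C \<xi> b *v x)"
    "\<And>b x. b0 \<le> b \<Longrightarrow> (c * b)\<^sup>2 * (norm (coord_proj C *v x))\<^sup>2 \<le> x \<bullet> (G_mat S K C \<xi> b *v x)"
    "\<And>b x. b0 \<le> b \<Longrightarrow> coord_proj C *v x = 0 \<Longrightarrow> x \<bullet> (G_mat S K C \<xi> b *v x) \<le> a * (norm x)\<^sup>2"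
    "\<And>b x. b0 \<le> b \<Longrightarrow> x \<bullet> (G_mat S K C \<xi> b *v x) \<le> h * b\<^sup>2 * (norm x)\<^sup>2"
proof (rule A_hat_adjoint_lower_bounds[OF partition D S_DD xi])
  fix m b0
  assume m: "0 < m" and b0: "0 < b0" and lower:
      "\<And>b x. b0 \<le> b \<Longrightarrow> norm x \<le> m * norm (conj_transpose (A_hat S C \<xi> b) *v x)"
      "\<And>b x. b0 \<le> b \<Longrightarrow> b * norm (coord_proj C *v x) \<le> m * norm (conj_transpose (A_hat S C \<xi> b) *v x)"
  obtain s where s: "0 < s" "\<And>x. norm (conj_transpose S *v x) \<le> s * norm x"
    using matrix_norm_bound by blast
  have herm: "conj_transpose K = K"
    using K by (simp add: hermitian_pos_def_def)
  define k where "k = lambda_min K"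
  define k' where "k' = lambda_max K"
  have k: "0 < k" and Kge: "k * (norm y)\<^sup>2 \<le> y \<bullet> (K *v y)" and Kle: "y \<bullet> (K *v y) \<le> k' * (norm y)\<^sup>2" for y
    using lambda_min_pos[OF K] rayleigh_ge_lambda_min[OF herm] rayleigh_le_lambda_max[OF herm]
    by (simp_all add: k_def k'_def)
  have k': "0 < k'"
  proof -
    obtain y :: "complex^'a" where "norm y = 1"
      by (rule vector_choose_size[of 1]) simp_all
    then show ?thesis
      using Kge[of y] Kle[of y] k by simp
  qed
  define c where "c = sqrt k / m"
  define a where "a = k' * s\<^sup>2"
  define h where "h = k' * (s + \<bar>\<xi>\<bar>)\<^sup>2"
  have pos: "0 < c\<^sup>2" "0 < c" "0 < a" "0 < h"
    using k k' m s by (simp_all add: c_def a_def h_def add_pos_nonneg)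
  have final: "c\<^sup>2 * (norm x)\<^sup>2 \<le> x \<bullet> (G_mat S K C \<xi> b *v x) \<and>
      (c * b)\<^sup>2 * (norm (coord_proj C *v x))\<^sup>2 \<le> x \<bullet> (G_mat S K C \<xi> b *v x) \<and>
      (coord_proj C *v x = 0 \<longrightarrow> x \<bullet> (G_mat S K C \<xi> b *v x) \<le> a * (norm x)\<^sup>2) \<and>
      x \<bullet> (G_mat S K C \<xi> b *v x) \<le> h * b\<^sup>2 * (norm x)\<^sup>2" if b: "max b0 1 \<le> b" for b x
  proof -
    define y where "y = conj_transpose (A_hat S C \<xi> b) *v x"
    have form: "x \<bullet> (G_mat S K C \<xi> b *v x) = y \<bullet> (K *v y)"
      by (simp add: G_mat_form y_def)
    have below: "c\<^sup>2 * z\<^sup>2 \<le> y \<bullet> (K *v y)" if "z \<le> m * norm y" "0 \<le> z" for z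
    proof -
      have "z\<^sup>2 \<le> (m * norm y)\<^sup>2"
        using that by (intro power_mono)
      then have "c\<^sup>2 * z\<^sup>2 \<le> c\<^sup>2 * (m * norm y)\<^sup>2"
        using pos by simp
      also have "\<dots> = k * (norm y)\<^sup>2"
        using k m by (simp add: c_def power_mult_distrib power_divide)
      finally show ?thesis
        using Kge[of y] by simp
    qed
    have above: "y \<bullet> (K *v y) \<le> k' * z\<^sup>2" if "norm y \<le> z" for z
    proof -
      have "k' * (norm y)\<^sup>2 \<le> k' * z\<^sup>2"
        using that k' by (simp add: power_mono)
      then show ?thesis
        using Kle[of y] by simp
    qed
    have y: "y = conj_transpose S *v x - (\<i> * complex_of_real (b * \<xi>)) *s (coord_proj C *v x)"
      by (simp add: y_def A_hat_adjoint_mult)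
    have "norm y \<le> norm (conj_transpose S *v x) + b * \<bar>\<xi>\<bar> * norm (coord_proj C *v x)"
    proof -
      have "norm ((\<i> * complex_of_real (b * \<xi>)) *s (coord_proj C *v x)) = b * \<bar>\<xi>\<bar> * norm (coord_proj C *v x)"
        using b by (simp add: norm_complex_smult norm_mult)
      then show ?thesis
        unfolding y by (metis norm_triangle_ineq4)
    qed
    also have "\<dots> \<le> s * norm x + b * \<bar>\<xi>\<bar> * norm x"
      using s(2) norm_coord_proj_le[of C x] b by (intro add_mono mult_left_mono) auto
    also have "\<dots> \<le> b * (s * norm x) + b * \<bar>\<xi>\<bar> * norm x"
      using b s(1) mult_right_mono[of 1 b "s * norm x"] by simp
    finally have "norm y \<le> b * (s + \<bar>\<xi>\<bar>) * norm x"
      by (simp add: algebra_simps)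
    note up = above[OF this]
    have soft: "y \<bullet> (K *v y) \<le> k' * (s * norm x)\<^sup>2" if "coord_proj C *v x = 0"
      using s(2)[of x] that by (intro above) (simp add: y)
    have low: "norm x \<le> m * norm y" "b * norm (coord_proj C *v x) \<le> m * norm y"
      using lower(1)[of b x] lower(2)[of b x] b by (simp_all add: y_def)
    show ?thesis
      unfolding form using below[OF low(1)] below[OF low(2)] up soft b
      by (simp add: a_def h_def power_mult_distrib mult_ac)
  qed
  show thesis
  proof (rule that[OF pos])
    show "0 < max b0 1"
      by simp
  qed (use final in blast)+
qed

section \<open>Iteration counts\<close>

lemma residual_eq_descent_iter: "residual G r j = descent_iter ((*v) G) (lambda_max G) j r"
proof -
  have "(c *\<^sub>R G) *v x = c *\<^sub>R (G *v x)" for c x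
    by (simp add: matrix_vector_mult_def vec_eq_iff scaleR_sum_right)
  then show ?thesis
    by (simp add: residual_def descent_iter_def matrix_vector_mult_diff_rdistrib)
qed

lemma Inf_enat_mem: "A \<noteq> {} \<Longrightarrow> Inf A \<in> A" for A :: "enat set"
  unfolding Inf_enat_def using LeastI_ex[of "\<lambda>n. n \<in> A"] by auto

locale residual_descent =
  split_descent "(*v) G" B "lambda_min G" "lambda_max G" "(*v) (coord_proj C)" a \<beta>
  for G :: "complex^'n^'n" and B C a \<beta> +
  fixes D :: "'n set" and iC :: "'c::finite \<Rightarrow> 'n" and iD :: "'d::finite \<Rightarrow> 'n"
  assumes partition: "C \<union> D = UNIV" "C \<inter> D = {}"
    and enum_C: "bij_betw iC UNIV C" and enum_D: "bij_betw iD UNIV D"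
begin

lemma norm_subvec: "norm (subvec iC x) = norm (coord_proj C *v x)" "norm (subvec iD x) = norm (q x)"
  by (simp_all only: norm_coord_proj[OF enum_C] norm_coord_proj[OF enum_D] coord_proj_complement[OF partition])

lemma iterations_le:
  assumes "norm (q (iter j r)) \<le> \<tau> * norm (q r)"
  shows "iterations iD G \<tau> r \<le> enat j"
  unfolding iterations_def using assms
  by (intro Inf_lower) (auto simp: norm_subvec residual_eq_descent_iter)

lemma iterations_ge:
  assumes "\<And>j. norm (q (iter j r)) \<le> \<tau> * norm (q r) \<Longrightarrow> x \<le> real j"
  shows "ereal x \<le> ereal_of_enat (iterations iD G \<tau> r)"
proof (cases "iterations iD G \<tau> r")
  case (enat j)
  let ?A = "{enat j | j. norm (q (iter j r)) \<le> \<tau> * norm (q r)}"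
  have eq: "iterations iD G \<tau> r = Inf ?A"
    by (simp add: iterations_def norm_subvec residual_eq_descent_iter)
  have "?A \<noteq> {}"
  proof
    assume "?A = {}"
    then have "Inf ?A = \<infinity>"
      by (simp only: Inf_enat_def) simp
    then show False
      using enat eq by simp
  qed
  then have "Inf ?A \<in> ?A"
    by (rule Inf_enat_mem)
  then have "norm (q (iter j r)) \<le> \<tau> * norm (q r)"
    using enat eq by auto
  then show ?thesis
    using assms enat by simp
qed simp

lemma initial_residual_bounds:
  assumes "r \<in> initial_residuals iC iD G M"
  shows "norm (coord_proj C *v r) \<le> M * norm (q r)" "q r \<noteq> 0"
proof -
  have "norm (subvec iC r) \<le> M * norm (subvec iD r)" "norm (subvec iD r) \<noteq> 0"
    using assms by (auto simp: initial_residuals_def)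
  then show "norm (coord_proj C *v r) \<le> M * norm (q r)" "q r \<noteq> 0"
    unfolding norm_subvec by auto
qed

lemma slow_mode_initial_residual:
  assumes M: "0 < M" and v: "slow_mode G v" and small: "\<delta> * (1 + M) \<le> M" "\<delta> < 1"
  shows "v \<in> initial_residuals iC iD G M" "norm (subvec iD v) \<le> 1" "cdot v v = 1"
proof -
  have Gv: "G *v v = lambda_min G *\<^sub>R v" and nv: "norm v = 1"
    using v by (simp_all add: slow_mode_def eigenvector_def of_real_scale)
  have "v \<bullet> (G *v v) \<le> a * 1\<^sup>2"
    using l_le_a by (simp add: Gv dot_square_norm nv)
  then have p: "norm (coord_proj C *v v) \<le> \<delta>"
    using energy_imp_small[of v 1] by simp
  have "1 \<le> norm (coord_proj C *v v) + norm (q v)"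
    using norm_triangle_ineq[of "coord_proj C *v v" "q v"] nv by simp
  then have q: "1 - \<delta> \<le> norm (q v)"
    using p by simp
  have "\<delta> \<le> M * (1 - \<delta>)"
    using small by (simp add: algebra_simps)
  also have "\<dots> \<le> M * norm (q v)"
    using q M by simp
  finally have le: "norm (subvec iC v) \<le> M * norm (subvec iD v)"
    using p by (simp add: norm_subvec)
  have "cdot v v = complex_of_real (v \<bullet> v)"
    by (auto simp: complex_eq_iff inner_eq_Re_cdot cdot_def)
  then show vv: "cdot v v = 1"
    by (simp add: dot_square_norm nv)
  have "0 < norm (q v)"
    using q small by linarith
  then have "0 < norm (subvec iD v)"
    by (simp only: norm_subvec)
  then show "v \<in> initial_residuals iC iD G M"
    using v vv le by (auto simp: initial_residuals_def intro!: exI[of _ v])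
  show "norm (subvec iD v) \<le> 1"
    unfolding norm_subvec using norm_q_le[of v] nv by simp
qed

context
  fixes M \<tau> :: real
  assumes M: "0 < M" and \<tau>: "0 < \<tau>" "\<tau> < 1"
begin

lemma iterations_upper:
  assumes r: "r \<in> initial_residuals iC iD G M" and "\<delta> * M \<le> \<tau> - \<tau>\<^sup>2"
  shows "ereal_of_enat (iterations iD G \<tau> r) \<le> ereal (2 * kappa G * ln (1 / \<tau>) + 1)"
proof -
  obtain j where j: "norm (q (iter j r)) \<le> \<tau> * norm (q r)" "real j \<le> 2 * kappa G * ln (1 / \<tau>) + 1"
    using reduction_reached[OF initial_residual_bounds(1)[OF r] \<tau> assms(2)] unfolding kappa_def by blast
  have "ereal_of_enat (iterations iD G \<tau> r) \<le> ereal_of_enat (enat j)"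
    using iterations_le[OF j(1)] by (simp only: ereal_of_enat_le_iff)
  also have "\<dots> \<le> ereal (2 * kappa G * ln (1 / \<tau>) + 1)"
    using j(2) by simp
  finally show ?thesis .
qed

lemma iterations_lower:
  assumes r: "r \<in> initial_residuals iC iD G M" and "\<delta> * M \<le> sqrt \<tau> - \<tau>" "2 * a \<le> lambda_max G"
  shows "ereal (lambda_max G / (4 * a) * ln (1 / \<tau>)) \<le> ereal_of_enat (iterations iD G \<tau> r)"
  using reduction_time_ge[OF initial_residual_bounds(1)[OF r] \<tau> initial_residual_bounds(2)[OF r]] assms(2,3)
  by (intro iterations_ge)

text \<open>
  The complex number \<open>cdot v r\<close> becomes a real inner product after multiplying \<open>v\<close> by a phase, which
  does not change that it is a normalised slow mode.
\<close>

lemma iterations_slow_lower: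
  assumes r: "r \<in> initial_residuals iC iD G M" and v: "slow_mode G v" "cdot v r \<noteq> 0"
    and less: "lambda_min G < lambda_max G"
  shows "ereal (kappa G * (ln (1 / \<tau>) + ln (cmod (cdot v r) / norm (subvec iD r))
      - ln (1 + \<delta> * (1 + M) / \<tau>) - (ln (1 / \<tau>) + ln (1 + M)) * (lambda_min G / lambda_max G)))
    \<le> ereal_of_enat (iterations iD G \<tau> r)"
proof -
  define s where "s = cdot v r / complex_of_real (cmod (cdot v r))"
  define w where "w = s *s v"
  have s: "cmod s = 1"
    using v by (simp add: s_def norm_divide)
  have Gw: "G *v w = lambda_min G *\<^sub>R w"
    using v(1) by (simp add: w_def slow_mode_def eigenvector_def vector_scalar_commute of_real_scale[symmetric])
  have nw: "norm w = 1"
    using v(1) s by (simp add: w_def norm_complex_smult slow_mode_def)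
  have "cdot w r = cnj s * cdot v r"
    by (simp add: w_def cdot_def sum_distrib_left mult_ac)
  also have "\<dots> = complex_of_real (cmod (cdot v r))"
    using v(2) by (simp add: s_def complex_norm_square[symmetric] power2_eq_square mult.commute)
  finally have wr: "w \<bullet> r = cmod (cdot v r)"
    by (simp add: inner_eq_Re_cdot)
  show ?thesis
    unfolding kappa_def norm_subvec
    using slow_reduction_time_ge[OF initial_residual_bounds(1)[OF r] \<tau> initial_residual_bounds(2)[OF r] _ Gw nw]
      M less v(2) wr
    by (intro iterations_ge) simp
qed

end

end

text \<open>
  The extreme eigenvalues are located by testing the form on a coordinate vector from \<open>C\<close> and on one
  from \<open>D\<close>.
\<close>

lemma residual_descent_intro:
  fixes G :: "complex^'n^'n" and iC :: "'c::finite \<Rightarrow> 'n" and iD :: "'d::finite \<Rightarrow> 'n"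
  assumes partition: "C \<union> D = UNIV" "C \<inter> D = {}"
    and enum: "bij_betw iC UNIV C" "bij_betw iD UNIV D"
    and G: "conj_transpose G = G"
    and l0: "0 < l0" "\<And>x. l0 * (norm x)\<^sup>2 \<le> x \<bullet> (G *v x)"
    and \<beta>: "0 < \<beta>" "\<And>x. \<beta>\<^sup>2 * (norm (coord_proj C *v x))\<^sup>2 \<le> x \<bullet> (G *v x)"
    and a: "0 < a" "\<And>x. coord_proj C *v x = 0 \<Longrightarrow> x \<bullet> (G *v x) \<le> a * (norm x)\<^sup>2" "a \<le> \<beta>\<^sup>2"
  shows "\<exists>B. residual_descent G B C a \<beta> D iC iD" "\<beta>\<^sup>2 \<le> lambda_max G" "lambda_min G \<le> a"
proof -
  obtain B where "spectral ((*v) G) B"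
    using hermitian_spectral[OF G] by blast
  then interpret spectral "(*v) G" B .
  obtain c d where cd: "c \<in> C" "d \<in> D"
    using enum by (metis UNIV_I bij_betwE)
  have "coord_proj C *v axis c 1 = (axis c 1 :: complex^'n)"
    using cd by (auto simp: vec_eq_iff coord_proj_mult axis_def)
  then show L: "\<beta>\<^sup>2 \<le> lambda_max G"
    using \<beta>(2)[of "axis c 1"] rayleigh_le_lambda_max[OF G, of "axis c 1"] by simp
  have "coord_proj C *v axis d 1 = (0 :: complex^'n)"
    using cd partition by (auto simp: vec_eq_iff coord_proj_mult axis_def)
  from a(2)[OF this] show l: "lambda_min G \<le> a"
    using rayleigh_ge_lambda_min[OF G, of "axis d 1"] by simp
  have "residual_descent G B C a \<beta> D iC iD"
  proof unfold_locales
    show "0 < lambda_min G"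
      using l0 lambda_min_ge[OF G l0(2)] by simp
    show "lambda_min G \<le> ev b \<and> ev b \<le> lambda_max G" if "b \<in> B" for b
      using rayleigh_ge_lambda_min[OF G, of b] rayleigh_le_lambda_max[OF G, of b] norm_basis[OF that] by simp
    show "(coord_proj C *v x) \<bullet> y = x \<bullet> (coord_proj C *v y)" for x y
      by (rule coord_proj_adjoint)
    show "coord_proj C *v (coord_proj C *v x) = coord_proj C *v x" for x
      by (rule coord_proj_idem)
    show "a \<le> lambda_max G"
      using a L by simp
  qed (fact assms l)+
  then show "\<exists>B. residual_descent G B C a \<beta> D iC iD"
    by blast
qed

section \<open>The asymptotic bounds\<close>

lemma slow_mode_exists:
  assumes "conj_transpose G = G"
  shows "\<exists>v. slow_mode G v"
proof -
  obtain v where v: "v \<noteq> 0" "G *v v = lambda_min G *\<^sub>R v"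
    using extreme_eigenvalues_attained(1)[OF assms] by (auto simp: eigenvector_def of_real_scale)
  then have "slow_mode G (v /\<^sub>R norm v)"
    by (simp add: slow_mode_def eigenvector_def of_real_scale linear_scale[OF linear_complex_matrix])
  then show ?thesis
    by blast
qed

theorem proposition6p1:
  fixes S K :: "complex^'n^'n" and \<xi> :: real and \<epsilon> :: "'n \<Rightarrow> real"
    and C D :: "'n set" and iC :: "'c::finite \<Rightarrow> 'n" and iD :: "'d::finite \<Rightarrow> 'n"
  assumes n: "CARD('n) \<ge> 2"
    and partition: "C \<union> D = UNIV" "C \<inter> D = {}"
    and enum_C: "bij_betw iC UNIV C" and enum_D: "bij_betw iD UNIV D"
    and S_DD: "invertible (block iD iD S)"
    and xi: "\<xi> \<noteq> 0"
    and K: "hermitian_pos_def K"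
    and eps: "\<And>i. \<epsilon> i > 0"
  shows "rho iC iD K < 1 \<and>
    (\<exists>c1>0. \<exists>c2>0. \<forall>M>0. \<forall>\<tau>\<in>{0<..<1}.
      (\<exists>\<omega>. (\<omega> \<longlongrightarrow> 0) at_top \<and>
        (\<forall>\<^sub>F b in at_top.
          ereal (kappa (G_mat S K C \<xi> b) * ln (1 / \<tau>) * (1 + \<omega> b))
            \<le> ereal_of_enat (worst_iterations iC iD (G_mat S K C \<xi> b) M \<tau>))) \<and>
      (\<exists>\<omega>. (\<omega> \<longlongrightarrow> 0) at_top \<and>
        (\<forall>\<^sub>F b in at_top. \<forall>r0\<in>initial_residuals iC iD (G_mat S K C \<xi> b) M.
          \<forall>v. slow_mode (G_mat S K C \<xi> b) v \<and> cdot v r0 \<noteq> 0 \<longrightarrow>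
            ereal (kappa (G_mat S K C \<xi> b) *
                (ln (1 / \<tau>) + ln (cmod (cdot v r0) / norm (subvec iD r0)) + \<omega> b))
              \<le> ereal_of_enat (iterations iD (G_mat S K C \<xi> b) \<tau> r0))) \<and>
      (\<forall>\<^sub>F b in at_top. \<forall>r0\<in>initial_residuals iC iD (G_mat S K C \<xi> b) M.
          ereal (c1 * ((peclet \<epsilon> D \<xi> b)\<^sup>2 * ln (1 / \<tau>)))
            \<le> ereal_of_enat (iterations iD (G_mat S K C \<xi> b) \<tau> r0) \<and>
          ereal_of_enat (iterations iD (G_mat S K C \<xi> b) \<tau> r0)
            \<le> ereal (c2 * ((peclet \<epsilon> D \<xi> b)\<^sup>2 / (1 - (rho iC iD K)\<^sup>2) * ln (1 / \<tau>)))))"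
proof
  have inj: "inj iC" "inj iD" and range: "range iC = C" "range iD = D"
    using enum_C enum_D by (auto simp: bij_betw_def)
  show rho: "rho iC iD K < 1"
    using inj range partition(2) by (intro rho_less_1 K) auto
  have "0 \<le> rho iC iD K"
    unfolding rho_def spectral_norm_def
    by (intro onorm_pos_le) (simp add: linear_complex_matrix flip: linear_conv_bounded_linear)
  then have rho2: "0 < 1 - (rho iC iD K)\<^sup>2"
    using rho by (simp add: power_less_one_iff)
  define e where "e = Min (\<epsilon> ` D) * \<xi>"
  have "0 < Min (\<epsilon> ` D)"
    using range(2) eps by (subst Min_gr_iff) auto
  then have e: "0 < e\<^sup>2"
    using xi by (simp add: e_def)
  have peclet: "(peclet \<epsilon> D \<xi> b)\<^sup>2 = b\<^sup>2 / e\<^sup>2" for b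
    by (simp add: peclet_def e_def power_divide)
  have herm: "conj_transpose (G_mat S K C \<xi> b) = G_mat S K C \<xi> b" for b
    using K by (intro G_mat_hermitian) (simp add: hermitian_pos_def_def)
  obtain l0 c a h b0 where pos: "0 < l0" "0 < c" "0 < a" "0 < h" "0 < b0" and est:
    "\<And>b x. b0 \<le> b \<Longrightarrow> l0 * (norm x)\<^sup>2 \<le> x \<bullet> (G_mat S K C \<xi> b *v x)"
    "\<And>b x. b0 \<le> b \<Longrightarrow> (c * b)\<^sup>2 * (norm (coord_proj C *v x))\<^sup>2 \<le> x \<bullet> (G_mat S K C \<xi> b *v x)"
    "\<And>b x. b0 \<le> b \<Longrightarrow> coord_proj C *v x = 0 \<Longrightarrow> x \<bullet> (G_mat S K C \<xi> b *v x) \<le> a * (norm x)\<^sup>2"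
    "\<And>b x. b0 \<le> b \<Longrightarrow> x \<bullet> (G_mat S K C \<xi> b *v x) \<le> h * b\<^sup>2 * (norm x)\<^sup>2"
    by (rule G_mat_estimates[OF partition enum_D S_DD xi K]) (rule that)
  define d where "d b = sqrt a / (c * b)" for b
  have cb: "filterlim (\<lambda>b. c * b) at_top at_top"
    by (rule filterlim_tendsto_pos_mult_at_top[OF tendsto_const pos(2) filterlim_ident])
  have d: "(d \<longlongrightarrow> 0) at_top"
    unfolding d_def by (rule real_tendsto_divide_at_top[OF tendsto_const cb])
  have small: "\<forall>\<^sub>F b in at_top. d b * m < t" if "0 < t" for m t
    using order_tendstoD(2)[OF tendsto_mult_left_zero[OF d] that] by simp
  have square_large: "\<forall>\<^sub>F b in at_top. Z \<le> (c * b)\<^sup>2" for Z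
  proof -
    have "\<forall>\<^sub>F b in at_top. max 1 Z \<le> c * b"
      using cb unfolding filterlim_at_top by blast
    then show ?thesis
    proof eventually_elim
      case (elim b)
      then have "c * b * 1 \<le> c * b * (c * b)"
        by (intro mult_left_mono) auto
      then show ?case
        using elim by (simp add: power2_eq_square)
    qed
  qed
  define good where "good b \<longleftrightarrow> b0 \<le> b \<and> 2 * a \<le> (c * b)\<^sup>2" for b
  have good: "\<forall>\<^sub>F b in at_top. good b"
    unfolding good_def by (intro eventually_conj eventually_ge_at_top square_large)
  have descent: "\<exists>B. residual_descent (G_mat S K C \<xi> b) B C a (c * b) D iC iD"
    and lambda_max_ge: "(c * b)\<^sup>2 \<le> lambda_max (G_mat S K C \<xi> b)"
    and lambda_min_le: "lambda_min (G_mat S K C \<xi> b) \<le> a"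
    if "good b" for b
  proof -
    have b: "b0 \<le> b" and cb: "0 < c * b" "a \<le> (c * b)\<^sup>2"
      using that pos by (simp_all add: good_def zero_less_mult_iff)
    note * = partition enum_C enum_D herm pos(1) est(1)[OF b] cb(1) est(2)[OF b] pos(3) est(3)[OF b] cb(2)
    show "\<exists>B. residual_descent (G_mat S K C \<xi> b) B C a (c * b) D iC iD"
      by (rule residual_descent_intro(1)[OF *])
    show "(c * b)\<^sup>2 \<le> lambda_max (G_mat S K C \<xi> b)"
      by (rule residual_descent_intro(2)[OF *])
    show "lambda_min (G_mat S K C \<xi> b) \<le> a"
      by (rule residual_descent_intro(3)[OF *])
  qed
  have kappa_le: "kappa (G_mat S K C \<xi> b) \<le> h * b\<^sup>2 / l0" if "good b" for b
  proof -
    have b: "b0 \<le> b"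
      using that by (simp add: good_def)
    show ?thesis
      unfolding kappa_def
      using pos lambda_min_ge[OF herm est(1)[OF b]] lambda_max_le[OF herm est(4)[OF b]]
      by (intro frac_le) auto
  qed
  \<comment> \<open>The lower bound is \<open>\<lambda>\<^sub>m\<^sub>a\<^sub>x / (4 a) ln (1/\<tau>)\<close> with \<open>\<lambda>\<^sub>m\<^sub>a\<^sub>x \<ge> (c b)\<^sup>2\<close>; the upper one is
    \<open>2 \<kappa> ln (1/\<tau>) + 1\<close> with \<open>\<kappa> \<le> h b\<^sup>2 / l0\<close>, where a third multiple absorbs the \<open>+ 1\<close>. The constant
    \<open>c2\<close> cancels the factor \<open>1 / (1 - \<rho>\<^sup>2)\<close>, which does not depend on \<open>b\<close>.\<close>
  define c1 where "c1 = c\<^sup>2 * e\<^sup>2 / (4 * a)"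
  define c2 where "c2 = 3 * (h / l0) * e\<^sup>2 * (1 - (rho iC iD K)\<^sup>2)"
  have c1: "0 < c1" and c2: "0 < c2"
    using pos e rho2 by (simp_all add: c1_def c2_def)
  show "\<exists>c1>0. \<exists>c2>0. \<forall>M>0. \<forall>\<tau>\<in>{0<..<1}.
      (\<exists>\<omega>. (\<omega> \<longlongrightarrow> 0) at_top \<and>
        (\<forall>\<^sub>F b in at_top.
          ereal (kappa (G_mat S K C \<xi> b) * ln (1 / \<tau>) * (1 + \<omega> b))
            \<le> ereal_of_enat (worst_iterations iC iD (G_mat S K C \<xi> b) M \<tau>))) \<and>
      (\<exists>\<omega>. (\<omega> \<longlongrightarrow> 0) at_top \<and>
        (\<forall>\<^sub>F b in at_top. \<forall>r0\<in>initial_residuals iC iD (G_mat S K C \<xi> b) M.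
          \<forall>v. slow_mode (G_mat S K C \<xi> b) v \<and> cdot v r0 \<noteq> 0 \<longrightarrow>
            ereal (kappa (G_mat S K C \<xi> b) *
                (ln (1 / \<tau>) + ln (cmod (cdot v r0) / norm (subvec iD r0)) + \<omega> b))
              \<le> ereal_of_enat (iterations iD (G_mat S K C \<xi> b) \<tau> r0))) \<and>
      (\<forall>\<^sub>F b in at_top. \<forall>r0\<in>initial_residuals iC iD (G_mat S K C \<xi> b) M.
          ereal (c1 * ((peclet \<epsilon> D \<xi> b)\<^sup>2 * ln (1 / \<tau>)))
            \<le> ereal_of_enat (iterations iD (G_mat S K C \<xi> b) \<tau> r0) \<and>
          ereal_of_enat (iterations iD (G_mat S K C \<xi> b) \<tau> r0)
            \<le> ereal (c2 * ((peclet \<epsilon> D \<xi> b)\<^sup>2 / (1 - (rho iC iD K)\<^sup>2) * ln (1 / \<tau>))))"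
  proof (rule exI[of _ c1], rule conjI[OF c1], rule exI[of _ c2], rule conjI[OF c2], intro allI impI ballI conjI)
    fix M \<tau> :: real
    assume M: "0 < M" and "\<tau> \<in> {0<..<1}"
    then have \<tau>: "0 < \<tau>" "\<tau> < 1"
      by simp_all
    define \<Lambda> where "\<Lambda> = ln (1 / \<tau>)"
    have \<Lambda>: "0 < \<Lambda>"
      using \<tau> by (simp add: \<Lambda>_def)
    \<comment> \<open>The corrections for a slow mode, with the ratio of the extreme eigenvalues replaced by its
      upper bound \<open>a / (c b)\<^sup>2 = (d b)\<^sup>2\<close>, which makes them explicit functions of \<open>b\<close>.\<close>
    define \<omega> where "\<omega> b = - ln (1 + d b * (1 + M) / \<tau>) - (\<Lambda> + ln (1 + M)) * (d b)\<^sup>2" for b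
    have \<omega>: "(\<omega> \<longlongrightarrow> 0) at_top"
      unfolding \<omega>_def using \<tau> by (auto intro!: tendsto_eq_intros d)
    have slow: "\<forall>\<^sub>F b in at_top. \<forall>r0\<in>initial_residuals iC iD (G_mat S K C \<xi> b) M.
        \<forall>v. slow_mode (G_mat S K C \<xi> b) v \<and> cdot v r0 \<noteq> 0 \<longrightarrow>
          ereal (kappa (G_mat S K C \<xi> b) *
              (\<Lambda> + ln (cmod (cdot v r0) / norm (subvec iD r0)) + \<omega> b))
            \<le> ereal_of_enat (iterations iD (G_mat S K C \<xi> b) \<tau> r0)"
      using good
    proof (eventually_elim, intro ballI allI impI, elim conjE)
      fix b r v
      let ?G = "G_mat S K C \<xi> b"
      assume b: "good b" and r: "r \<in> initial_residuals iC iD ?G M"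
        and v: "slow_mode ?G v" "cdot v r \<noteq> 0"
      obtain B where "residual_descent ?G B C a (c * b) D iC iD"
        using descent[OF b] by blast
      then interpret residual_descent ?G B C a "c * b" D iC iD .
      have \<delta>: "\<delta> = d b"
        by (simp add: \<delta>_def d_def)
      have less: "lambda_min ?G < lambda_max ?G"
        using lambda_min_le[OF b] lambda_max_ge[OF b] b a_pos by (simp add: good_def)
      have "lambda_min ?G / lambda_max ?G \<le> a / (c * b)\<^sup>2"
        using lambda_min_le[OF b] lambda_max_ge[OF b] a_pos \<beta>_pos by (intro frac_le) auto
      also have "\<dots> = (d b)\<^sup>2"
        using a_pos by (simp add: d_def power_divide)
      finally have "(\<Lambda> + ln (1 + M)) * (lambda_min ?G / lambda_max ?G) \<le> (\<Lambda> + ln (1 + M)) * (d b)\<^sup>2"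
        using \<Lambda> M by (intro mult_left_mono) simp_all
      moreover have "0 \<le> kappa ?G"
        using l_pos L_pos by (simp add: kappa_def)
      ultimately have "kappa ?G * (\<Lambda> + ln (cmod (cdot v r) / norm (subvec iD r)) + \<omega> b)
          \<le> kappa ?G * (\<Lambda> + ln (cmod (cdot v r) / norm (subvec iD r))
              - ln (1 + \<delta> * (1 + M) / \<tau>) - (\<Lambda> + ln (1 + M)) * (lambda_min ?G / lambda_max ?G))"
        unfolding \<omega>_def \<delta> by (intro mult_left_mono) simp_all
      then show "ereal (kappa ?G * (\<Lambda> + ln (cmod (cdot v r) / norm (subvec iD r)) + \<omega> b))
          \<le> ereal_of_enat (iterations iD ?G \<tau> r)"
        using iterations_slow_lower[OF M \<tau> r v less, folded \<Lambda>_def] order_trans ereal_less_eq(3) by blast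
    qed
    show "\<exists>\<omega>. (\<omega> \<longlongrightarrow> 0) at_top \<and>
        (\<forall>\<^sub>F b in at_top. \<forall>r0\<in>initial_residuals iC iD (G_mat S K C \<xi> b) M.
          \<forall>v. slow_mode (G_mat S K C \<xi> b) v \<and> cdot v r0 \<noteq> 0 \<longrightarrow>
            ereal (kappa (G_mat S K C \<xi> b) *
                (ln (1 / \<tau>) + ln (cmod (cdot v r0) / norm (subvec iD r0)) + \<omega> b))
              \<le> ereal_of_enat (iterations iD (G_mat S K C \<xi> b) \<tau> r0))"
      using \<omega> slow unfolding \<Lambda>_def by (intro exI[of _ \<omega>] conjI)
    \<comment> \<open>A slow mode \<open>v\<close> is an admissible initial residual for large \<open>b\<close>. Its slow component is \<open>1\<close> and
      \<open>\<parallel>v\<^sub>D\<parallel> \<le> 1\<close>, so the logarithm of their ratio is nonnegative.\<close>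
    have worst: "\<forall>\<^sub>F b in at_top. ereal (kappa (G_mat S K C \<xi> b) * \<Lambda> * (1 + \<omega> b / \<Lambda>))
        \<le> ereal_of_enat (worst_iterations iC iD (G_mat S K C \<xi> b) M \<tau>)"
      using slow good small[OF M, of "1 + M"] small[OF zero_less_one, of 1]
    proof eventually_elim
      case (elim b)
      let ?G = "G_mat S K C \<xi> b"
      obtain B where "residual_descent ?G B C a (c * b) D iC iD"
        using descent[OF elim(2)] by blast
      then interpret residual_descent ?G B C a "c * b" D iC iD .
      have \<delta>: "\<delta> = d b"
        by (simp add: \<delta>_def d_def)
      obtain v where v: "slow_mode ?G v"
        using slow_mode_exists[OF herm] by blast
      have "\<delta> * (1 + M) \<le> M" "\<delta> < 1"
        using elim(3,4) by (simp_all add: \<delta>)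
      note v_facts = slow_mode_initial_residual[OF M v this]
      have "0 < norm (subvec iD v)"
        using v_facts(1) by (simp add: initial_residuals_def)
      then have "0 \<le> ln (cmod (cdot v v) / norm (subvec iD v))"
        using v_facts(2,3) by (simp add: ln_ge_zero)
      moreover have "0 \<le> kappa ?G"
        using l_pos L_pos by (simp add: kappa_def)
      ultimately have "kappa ?G * (\<Lambda> + \<omega> b)
          \<le> kappa ?G * (\<Lambda> + ln (cmod (cdot v v) / norm (subvec iD v)) + \<omega> b)"
        by (intro mult_left_mono) simp_all
      also have "kappa ?G * (\<Lambda> + \<omega> b) = kappa ?G * \<Lambda> * (1 + \<omega> b / \<Lambda>)"
        using \<Lambda> by (simp add: algebra_simps)
      finally have "ereal (kappa ?G * \<Lambda> * (1 + \<omega> b / \<Lambda>))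
          \<le> ereal (kappa ?G * (\<Lambda> + ln (cmod (cdot v v) / norm (subvec iD v)) + \<omega> b))"
        by (simp only: ereal_less_eq(3))
      also have "\<dots> \<le> ereal_of_enat (iterations iD ?G \<tau> v)"
        using v_facts(1,3) v by (intro elim(1)[rule_format]) simp_all
      also have "\<dots> \<le> ereal_of_enat (worst_iterations iC iD ?G M \<tau>)"
        using v_facts(1) unfolding worst_iterations_def ereal_of_enat_le_iff by (intro SUP_upper)
      finally show ?case .
    qed
    have "((\<lambda>b. \<omega> b / \<Lambda>) \<longlongrightarrow> 0) at_top"
      using tendsto_divide[OF \<omega> tendsto_const, of \<Lambda>] \<Lambda> by simp
    then show "\<exists>\<omega>. (\<omega> \<longlongrightarrow> 0) at_top \<and>
        (\<forall>\<^sub>F b in at_top.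
          ereal (kappa (G_mat S K C \<xi> b) * ln (1 / \<tau>) * (1 + \<omega> b))
            \<le> ereal_of_enat (worst_iterations iC iD (G_mat S K C \<xi> b) M \<tau>))"
      using worst unfolding \<Lambda>_def by (intro exI[of _ "\<lambda>b. \<omega> b / ln (1 / \<tau>)"] conjI)
    have "0 < \<tau> - \<tau>\<^sup>2" "0 < sqrt \<tau> - \<tau>"
      using \<tau> real_sqrt_less_mono[of "\<tau>\<^sup>2" \<tau>] by (simp_all add: power2_eq_square)
    note small' = this[THEN small, of M]
    show "\<forall>\<^sub>F b in at_top. \<forall>r0\<in>initial_residuals iC iD (G_mat S K C \<xi> b) M.
          ereal (c1 * ((peclet \<epsilon> D \<xi> b)\<^sup>2 * ln (1 / \<tau>)))
            \<le> ereal_of_enat (iterations iD (G_mat S K C \<xi> b) \<tau> r0) \<and>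
          ereal_of_enat (iterations iD (G_mat S K C \<xi> b) \<tau> r0)
            \<le> ereal (c2 * ((peclet \<epsilon> D \<xi> b)\<^sup>2 / (1 - (rho iC iD K)\<^sup>2) * ln (1 / \<tau>)))"
      using good small' square_large[of "c\<^sup>2 * l0 / (h * \<Lambda>)"]
    proof (eventually_elim, intro ballI)
      fix b r
      let ?G = "G_mat S K C \<xi> b"
      assume b: "good b" and small: "d b * M < \<tau> - \<tau>\<^sup>2" "d b * M < sqrt \<tau> - \<tau>"
        and large: "c\<^sup>2 * l0 / (h * \<Lambda>) \<le> (c * b)\<^sup>2" and r: "r \<in> initial_residuals iC iD ?G M"
      obtain B where "residual_descent ?G B C a (c * b) D iC iD"
        using descent[OF b] by blast
      then interpret residual_descent ?G B C a "c * b" D iC iD .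
      have \<delta>: "\<delta> = d b"
        by (simp add: \<delta>_def d_def)
      have "c1 * (b\<^sup>2 / e\<^sup>2 * \<Lambda>) = (c * b)\<^sup>2 / (4 * a) * \<Lambda>"
        using e by (simp add: c1_def power_mult_distrib)
      also have "\<dots> \<le> lambda_max ?G / (4 * a) * \<Lambda>"
        using lambda_max_ge[OF b] a_pos \<Lambda> by (intro mult_right_mono divide_right_mono) simp_all
      finally have "ereal (c1 * (b\<^sup>2 / e\<^sup>2 * \<Lambda>)) \<le> ereal (lambda_max ?G / (4 * a) * \<Lambda>)"
        by (simp only: ereal_less_eq(3))
      also have "\<dots> \<le> ereal_of_enat (iterations iD ?G \<tau> r)"
        unfolding \<Lambda>_def using b lambda_max_ge[OF b] small
        by (intro iterations_lower[OF M \<tau> r]) (simp_all add: \<delta> good_def)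
      finally have lower: "ereal (c1 * (b\<^sup>2 / e\<^sup>2 * \<Lambda>)) \<le> ereal_of_enat (iterations iD ?G \<tau> r)" .
      have "1 \<le> h * b\<^sup>2 / l0 * \<Lambda>"
        using large pos \<Lambda> by (simp add: field_simps power_mult_distrib)
      moreover have "kappa ?G * \<Lambda> \<le> h * b\<^sup>2 / l0 * \<Lambda>"
        using kappa_le[OF b] \<Lambda> by (intro mult_right_mono) simp_all
      moreover have "2 * x + 1 \<le> 3 * y" if "1 \<le> y" "x \<le> y" for x y :: real
        using that by linarith
      ultimately have "2 * (kappa ?G * \<Lambda>) + 1 \<le> 3 * (h * b\<^sup>2 / l0 * \<Lambda>)"
        by blast
      then have "2 * kappa ?G * \<Lambda> + 1 \<le> 3 * (h * b\<^sup>2 / l0 * \<Lambda>)"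
        by (simp only: mult.assoc)
      also have "\<dots> = c2 * (b\<^sup>2 / e\<^sup>2 / (1 - (rho iC iD K)\<^sup>2) * \<Lambda>)"
        using e rho2 by (simp add: c2_def)
      finally have le: "ereal (2 * kappa ?G * \<Lambda> + 1)
          \<le> ereal (c2 * (b\<^sup>2 / e\<^sup>2 / (1 - (rho iC iD K)\<^sup>2) * \<Lambda>))"
        by (simp only: ereal_less_eq(3))
      have "ereal_of_enat (iterations iD ?G \<tau> r) \<le> ereal (2 * kappa ?G * \<Lambda> + 1)"
        unfolding \<Lambda>_def using small by (intro iterations_upper[OF M \<tau> r]) (simp add: \<delta>)
      also note le
      finally show "ereal (c1 * ((peclet \<epsilon> D \<xi> b)\<^sup>2 * ln (1 / \<tau>)))
            \<le> ereal_of_enat (iterations iD ?G \<tau> r) \<and>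
          ereal_of_enat (iterations iD ?G \<tau> r)
            \<le> ereal (c2 * ((peclet \<epsilon> D \<xi> b)\<^sup>2 / (1 - (rho iC iD K)\<^sup>2) * ln (1 / \<tau>)))"
        using lower unfolding peclet \<Lambda>_def by blast
    qed
  qed
qed

end
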